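(* Let $\Gamma$ be the dual graph of one of the five types of rational nodal plane quartics, let $B$ be the Riemann matrix of $\Gamma$, let $B_0$ be a symmetric $3\times 3$ matrix (real or complex) with positive definite real part, and set $B_t = tB+B_0$ for $t\ge 0$. Let $\mathbf{a}\in\mathbb{R}^3$ be a vertex of the Voronoi cell of the origin with respect to the lattice $\mathbb{Z}^3$ and the metric defined by $B$, and let $\mathcal{D}_{\mathbf{a},B}\subset\mathbb{Z}^3$ be the set of vertices of the Delaunay polytope dual to $\mathbf{a}$. Then the theta function associated with the degeneration $B_t$ and the vertex $\mathbf{a}$ is a finite sum over $\mathcal{D}_{\mathbf{a},B}$; that is, for every $\mathbf{x}\in\mathbb{C}^3$, $$\lim_{t\to+\infty}\theta\bigl(\mathbf{x}-i\,tB\mathbf{a},\,B_t\bigr)\;=\;\sum_{n\in\mathcal{D}_{\mathbf{a},B}}\mathbf{e}\Bigl(-\tfrac12\, n^TB_0n+i\,n^T\mathbf{x}\Bigr).$$ The number $|\mathcal{D}_{\mathbf{a},B}|$ of summands equals $8$ for an irreducible rational quartic, $6$ for a nodal cubic plus a line, $4$ or $6$ (depending on the vertex $\mathbf{a}$) for two conics, $4$ or $5$ (depending on the vertex $\mathbf{a}$) for a conic plus two lines, and $4$ for four lines.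
   Context: Notation: $\mathbf{e}(t):=\exp(2\pi t)$. For a symmetric matrix $M\in\mathbb{C}^{3\times3}$ with positive definite real part and $\mathbf{x}\in\mathbb{C}^3$, the Riemann theta function is $$\theta(\mathbf{x},M)=\sum_{n\in\mathbb{Z}^3}\mathbf{e}\Bigl(-\tfrac12 n^TMn+i\,n^T\mathbf{x}\Bigr).$$ Rational nodal quartics: reduced plane quartic curves all of whose irreducible components are rational and whose only singularities are nodes. The five types are: (1) an irreducible quartic with three nodes; (2) a nodal cubic together with a line; (3) two smooth conics; (4) a smooth conic with two lines; (5) four lines (with only nodal intersections in every case). The dual graph $\Gamma=(V,E)$ has one vertex per irreducible component and one edge for each intersection point of two components; a node of a single component gives a loop at that vertex. So the graphs are: (1) one vertex with three loops; (2) two vertices joined by three edges, with one loop at one of the vertices; (3) two vertices joined by four edges; (4) three vertices $C,L_1,L_2$ with two edges $CL_1$, two edges $CL_2$ and one edge $L_1L_2$; (5) the complete graph $K_4$. Riemann matrix of $\Gamma$: orient the edges of $\Gamma$. The group $H_1(\Gamma,\mathbb{Z})=\ker(\partial:\mathbb{Z}^E\to\mathbb{Z}^V)$ is free of rank $3$. Choose a $\mathbb{Z}$-basis and let $\Omega$ be the $3\times|E|$ matrix whose rows are the coordinates of the basis elements in $\mathbb{Z}^E$. Set $B:=\Omega\,\Omega^T$, a positive definite symmetric matrix; changing orientations or basis replaces $B$ by $gBg^T$ with $g\in\mathrm{GL}(3,\mathbb{Z})$. For suitable choices the five matrices are $$(1)\ \begin{pmatrix}1&0&0\\0&1&0\\0&0&1\end{pmatrix},\quad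 (2)\ \begin{pmatrix}2&-1&0\\-1&2&0\\0&0&1\end{pmatrix},\quad (3)\ \begin{pmatrix}2&-1&0\\-1&2&-1\\0&-1&2\end{pmatrix},\quad (4)\ \begin{pmatrix}2&-1&0\\-1&3&-1\\0&-1&2\end{pmatrix},\quad (5)\ \begin{pmatrix}3&-1&-1\\-1&3&-1\\-1&-1&3\end{pmatrix}.$$ Voronoi cell and Delaunay polytopes: the Voronoi cell of the origin with respect to $\mathbb{Z}^3$ and $B$ is the polytope $$\{\mathbf{a}\in\mathbb{R}^3 : \mathbf{a}^TB\mathbf{a}\le(\mathbf{a}-n)^TB(\mathbf{a}-n)\ \text{ for all } n\in\mathbb{Z}^3\}.$$ For a vertex $\mathbf{a}$ of this polytope, $\mathcal{D}_{\mathbf{a},B}$ is the set of all $n\in\mathbb{Z}^3$ with $\mathbf{a}^TB\mathbf{a}=(\mathbf{a}-n)^TB(\mathbf{a}-n)$, i.e. the set of lattice points closest to $\mathbf{a}$ in the metric given by $B$. The Delaunay polytope dual to $\mathbf{a}$ is $\mathrm{conv}(\mathcal{D}_{\mathbf{a},B})$, and its vertices are exactly the elements of $\mathcal{D}_{\mathbf{a},B}$. The theta function associated with the degeneration $B_t=tB+B_0$ and the vertex $\mathbf{a}$ is the limit of $\theta(\mathbf{x}-i\,tB\mathbf{a},B_t)$ as $t\to+\infty$. *)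

theory Defs
  imports "HOL-Analysis.Analysis" "Graph_Theory.Digraph"
begin

section \<open>Theta functions\<close>

abbreviation real_vec :: "int ^ 3 \<Rightarrow> real ^ 3" where
  "real_vec n \<equiv> (\<chi> i. real_of_int (n $ i))"

abbreviation complex_vec :: "real ^ 3 \<Rightarrow> complex ^ 3" where
  "complex_vec v \<equiv> (\<chi> i. complex_of_real (v $ i))"

abbreviation complex_mat :: "real ^ 3 ^ 3 \<Rightarrow> complex ^ 3 ^ 3" where
  "complex_mat M \<equiv> (\<chi> i j. complex_of_real (M $ i $ j))"

abbreviation Re_mat :: "complex ^ 3 ^ 3 \<Rightarrow> real ^ 3 ^ 3" where
  "Re_mat M \<equiv> (\<chi> i j. Re (M $ i $ j))"

definition pos_def_mat :: "real ^ 3 ^ 3 \<Rightarrow> bool" where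
  "pos_def_mat M \<longleftrightarrow> transpose M = M \<and> (\<forall>v. v \<noteq> 0 \<longrightarrow> 0 < v \<bullet> (M *v v))"

text \<open>The normalisation is \<open>exp (2 \<pi> z)\<close>, without a factor \<open>\<i>\<close>.\<close>
definition ee :: "complex \<Rightarrow> complex" where
  "ee z = exp (2 * of_real pi * z)"

text \<open>The bilinear (not sesquilinear) product; \<open>\<bullet>\<close> on complex vectors is real-valued.\<close>
definition cdot :: "complex ^ 3 \<Rightarrow> complex ^ 3 \<Rightarrow> complex" where
  "cdot v w = (\<Sum>i\<in>UNIV. v $ i * w $ i)"

definition theta_term :: "complex ^ 3 \<Rightarrow> complex ^ 3 ^ 3 \<Rightarrow> int ^ 3 \<Rightarrow> complex" where
  "theta_term x M n =
     (let m = complex_vec (real_vec n) in ee (- (1/2) * cdot m (M *v m) + \<i> * cdot m x))"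

definition riemann_theta :: "complex ^ 3 \<Rightarrow> complex ^ 3 ^ 3 \<Rightarrow> complex" where
  "riemann_theta x M = (\<Sum>\<^sub>\<infinity>n\<in>UNIV. theta_term x M n)"


section \<open>Dual graphs of rational nodal quartics\<close>

datatype quartic_type =
    Irreducible_Quartic
  | Nodal_Cubic_And_Line
  | Two_Conics
  | Conic_And_Two_Lines
  | Four_Lines

text \<open>For each irreducible component, its degree and its number of nodes
  (nodes at which the component meets itself).\<close>
fun components :: "quartic_type \<Rightarrow> (nat \<times> nat) list" where
  "components Irreducible_Quartic = [(4, 3)]"
| "components Nodal_Cubic_And_Line = [(3, 1), (1, 0)]"
| "components Two_Conics = [(2, 0), (2, 0)]"
| "components Conic_And_Two_Lines = [(2, 0), (1, 0), (1, 0)]"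
| "components Four_Lines = [(1, 0), (1, 0), (1, 0), (1, 0)]"

text \<open>Number of edges between the vertices of two components. The nodes of a component give loops.
  Distinct components of degrees \<open>d\<close> and \<open>e\<close> only meet in nodes of the curve, that is
  transversally, so that they have \<open>d * e\<close> intersection points.\<close>
definition num_edges :: "quartic_type \<Rightarrow> nat \<Rightarrow> nat \<Rightarrow> nat" where
  "num_edges T i j =
     (if i = j then snd (components T ! i)
      else fst (components T ! i) * fst (components T ! j))"

text \<open>\<open>G\<close> is the dual graph of a quartic of type \<open>T\<close>, endowed with an arbitrary orientation
  of its edges and with arbitrary names of vertices and edges: an edge is an arc of the
  multidigraph \<open>G\<close>, oriented from its tail to its head.\<close>
definition oriented_dual_graph :: "quartic_type \<Rightarrow> ('v, 'e) pre_digraph \<Rightarrow> bool" where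
  "oriented_dual_graph T G \<longleftrightarrow> fin_digraph G \<and>
     (\<exists>\<phi>. bij_betw \<phi> {..<length (components T)} (verts G) \<and>
        (\<forall>i<length (components T). \<forall>j<length (components T).
           card {e \<in> arcs G. {tail G e, head G e} = {\<phi> i, \<phi> j}} = num_edges T i j))"


section \<open>Riemann matrices of graphs\<close>

definition boundary :: "('v, 'e) pre_digraph \<Rightarrow> ('e \<Rightarrow> int) \<Rightarrow> 'v \<Rightarrow> int" where
  "boundary G c v =
     (\<Sum>e\<in>{e \<in> arcs G. head G e = v}. c e) - (\<Sum>e\<in>{e \<in> arcs G. tail G e = v}. c e)"

text \<open>The elements of \<open>\<int>\<^sup>E\<close> are the functions vanishing outside \<open>arcs G\<close>.\<close>
definition H1 :: "('v, 'e) pre_digraph \<Rightarrow> ('e \<Rightarrow> int) set" where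
  "H1 G = {c. (\<forall>e. e \<notin> arcs G \<longrightarrow> c e = 0) \<and> (\<forall>v\<in>verts G. boundary G c v = 0)}"

definition is_H1_basis :: "('v, 'e) pre_digraph \<Rightarrow> (3 \<Rightarrow> 'e \<Rightarrow> int) \<Rightarrow> bool" where
  "is_H1_basis G \<omega> \<longleftrightarrow>
     (\<forall>i. \<omega> i \<in> H1 G) \<and>
     (\<forall>c\<in>H1 G. \<exists>!k :: 3 \<Rightarrow> int. c = (\<lambda>e. \<Sum>i\<in>UNIV. k i * \<omega> i e))"

text \<open>\<open>B = \<Omega> \<Omega>\<^sup>T\<close>, where the rows of \<open>\<Omega>\<close> are the elements \<open>\<omega> i\<close> of some basis of \<open>H1 G\<close>.\<close>
definition is_riemann_matrix :: "('v, 'e) pre_digraph \<Rightarrow> real ^ 3 ^ 3 \<Rightarrow> bool" where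
  "is_riemann_matrix G B \<longleftrightarrow>
     (\<exists>\<omega>. is_H1_basis G \<omega> \<and>
          B = (\<chi> i j. real_of_int (\<Sum>e\<in>arcs G. \<omega> i e * \<omega> j e)))"


section \<open>Voronoi cell and Delaunay polytopes\<close>

definition qform :: "real ^ 3 ^ 3 \<Rightarrow> real ^ 3 \<Rightarrow> real" where
  "qform B v = v \<bullet> (B *v v)"

definition voronoi_cell :: "real ^ 3 ^ 3 \<Rightarrow> (real ^ 3) set" where
  "voronoi_cell B = {a. \<forall>n. qform B a \<le> qform B (a - real_vec n)}"

definition delaunay_set :: "real ^ 3 ^ 3 \<Rightarrow> real ^ 3 \<Rightarrow> (int ^ 3) set" where
  "delaunay_set B a = {n. qform B a = qform B (a - real_vec n)}"

definition delaunay_polytope :: "real ^ 3 ^ 3 \<Rightarrow> real ^ 3 \<Rightarrow> (real ^ 3) set" where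
  "delaunay_polytope B a = convex hull (real_vec ` delaunay_set B a)"

lemma qform_convex_combination:
  "qform B ((1 - u) *\<^sub>R p + u *\<^sub>R q) =
     (1 - u) * qform B p + u * qform B q - u * (1 - u) * qform B (p - q)"
  unfolding qform_def
  by (simp add: matrix_vector_right_distrib matrix_vector_mult_diff_distrib
      matrix_vector_mult_scaleR inner_add_left inner_add_right inner_diff_left inner_diff_right)
     (simp add: algebra_simps)

text \<open>The points of \<open>delaunay_set B a\<close> are exactly the vertices of the Delaunay polytope.\<close>
lemma vertices_delaunay_polytope:
  assumes "pos_def_mat B"
  shows "{v. v extreme_point_of delaunay_polytope B a} = real_vec ` delaunay_set B a"
proof -
  let ?D = "real_vec ` delaunay_set B a"
  let ?E = "{v. qform B (a - v) \<le> qform B a}"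
  have pos: "0 < qform B v" if "v \<noteq> 0" for v
    using assms that by (simp add: pos_def_mat_def qform_def)
  have comb: "qform B (a - ((1 - u) *\<^sub>R p + u *\<^sub>R q)) =
      (1 - u) * qform B (a - p) + u * qform B (a - q) - u * (1 - u) * qform B (q - p)" for u p q
  proof -
    have "a - ((1 - u) *\<^sub>R p + u *\<^sub>R q) = (1 - u) *\<^sub>R (a - p) + u *\<^sub>R (a - q)"
      by (simp add: algebra_simps)
    then show ?thesis
      using qform_convex_combination[of B u "a - p" "a - q"] by simp
  qed
  have convE: "convex ?E"
  proof (rule convexI)
    fix p q :: "real ^ 3" and s u :: real
    assume pq: "p \<in> ?E" "q \<in> ?E" and "0 \<le> s" and u: "0 \<le> u" "s + u = 1"
    then have s: "s = 1 - u" "0 \<le> 1 - u" by auto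
    have "0 \<le> qform B (q - p)"
      using pos[of "q - p"] by (cases "q - p = 0") (auto simp: qform_def)
    then have "0 \<le> u * (1 - u) * qform B (q - p)"
      using u s by simp
    moreover have "(1 - u) * qform B (a - p) + u * qform B (a - q) \<le> (1 - u) * qform B a + u * qform B a"
      using pq u s by (intro add_mono mult_left_mono) auto
    moreover have "(1 - u) * qform B a + u * qform B a = qform B a"
      by (simp add: algebra_simps)
    ultimately have "qform B (a - ((1 - u) *\<^sub>R p + u *\<^sub>R q)) \<le> qform B a"
      using comb[of u p q] by linarith
    then show "s *\<^sub>R p + u *\<^sub>R q \<in> ?E"
      by (simp add: s)
  qed
  have sub: "convex hull ?D \<subseteq> ?E"
    by (rule hull_minimal) (auto simp: delaunay_set_def convE)
  have "v extreme_point_of (convex hull ?D)" if v: "v \<in> ?D" for v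
    unfolding extreme_point_of_def
  proof (intro conjI ballI)
    show "v \<in> convex hull ?D" using v by (rule hull_inc)
    fix p q assume p: "p \<in> convex hull ?D" and q: "q \<in> convex hull ?D"
    show "v \<notin> open_segment p q"
    proof
      assume "v \<in> open_segment p q"
      then obtain u where u: "p \<noteq> q" "0 < u" "u < 1" "v = (1 - u) *\<^sub>R p + u *\<^sub>R q"
        by (auto simp: in_segment)
      have "0 < u * (1 - u) * qform B (q - p)"
        using u pos[of "q - p"] by simp
      moreover have "(1 - u) * qform B (a - p) + u * qform B (a - q) \<le> (1 - u) * qform B a + u * qform B a"
        using p q sub u by (intro add_mono mult_left_mono) auto
      moreover have "(1 - u) * qform B a + u * qform B a = qform B a"
        by (simp add: algebra_simps)
      ultimately have "qform B (a - v) < qform B a"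
        using comb[of u p q] unfolding u(4) by linarith
      with v show False by (auto simp: delaunay_set_def)
    qed
  qed
  then show ?thesis
    using extreme_point_of_convex_hull[of _ ?D]
    by (auto simp: delaunay_polytope_def)
qed

end

theory Submission
  imports Defs
begin

text \<open>Up to a change of basis, \<open>B\<close> is the Gram matrix \<open>\<Sum>k. w k w k\<^sup>T\<close> of integer linear forms: all five
  dual graphs are planar, so that their cycles are differences of potentials on the four faces,
  and \<open>w k\<close> is a difference of two of these potentials. This system of forms is unimodular, which
  makes the Voronoi cell a zonotope: \<open>a\<close> lies in the cell iff \<open>2 B a = \<Sum>k. s k w k\<close> with all
  \<open>\<bar>s k\<bar> \<le> 1\<close>. At a vertex, \<open>s k = \<plusminus>1\<close> for every such representation, hence \<open>s\<close> is an orientation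
  without directed cycles of the planar dual graph. Writing \<open>q\<close> for the quadratic form,
  \<open>q (a - n) - q a = \<Sum>k. w k(n) (w k(n) - s k)\<close> has nonnegative terms, so that the Delaunay set is
  \<open>{n. \<forall>k. w k(n) \<in> {0, s k}}\<close>, and there remain finitely many orientations to count.
  The limit of the theta function follows by dominated convergence.\<close>

section \<open>The limit of the theta function\<close>

lemma exp_neg_abs_summable: "(\<lambda>k::int. exp (- \<bar>real_of_int k\<bar>)) summable_on UNIV"
proof -
  have nat: "(\<lambda>k::nat. exp (- real k)) summable_on UNIV"
  proof -
    have "(\<lambda>k::nat. exp (- real k)) = (\<lambda>k. exp (-1) ^ k)"
      by (simp add: exp_of_nat_mult [symmetric])
    moreover have "summable (\<lambda>k. (exp (-1) :: real) ^ k)"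
      by (rule summable_geometric) simp
    ultimately show ?thesis
      by (intro norm_summable_imp_summable_on) simp
  qed
  have "(\<lambda>k. exp (- \<bar>real_of_int k\<bar>)) summable_on range int"
    using nat by (subst summable_on_reindex) (auto simp: o_def)
  moreover have "(\<lambda>k. exp (- \<bar>real_of_int k\<bar>)) summable_on range (\<lambda>k. - int k)"
    using nat by (subst summable_on_reindex) (auto simp: o_def inj_def)
  ultimately have "(\<lambda>k. exp (- \<bar>real_of_int k\<bar>)) summable_on (range int \<union> range (\<lambda>k. - int k))"
    by (rule summable_on_union)
  moreover have "range int \<union> range (\<lambda>k. - int k) = UNIV"
  proof -
    have "k \<in> range int \<union> range (\<lambda>k. - int k)" for k
      by (cases k rule: int_cases2) auto
    then show ?thesis by auto
  qed
  ultimately show ?thesis by simp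
qed

text \<open>The exponential of minus the l1 norm factors over the coordinates, which reduces the
  claim to one dimension. The result is the majorant for the theta series.\<close>

lemma exp_neg_abs_summable_lattice:
  "(\<lambda>n::int^3. exp (- (\<Sum>i\<in>UNIV. \<bar>real_of_int (n $ i)\<bar>))) summable_on UNIV"
proof -
  have "Infinite_Set_Sum.abs_summable_on (\<lambda>g::3 \<Rightarrow> int. \<Prod>i\<in>UNIV. exp (- \<bar>real_of_int (g i)\<bar>))
      (PiE UNIV (\<lambda>_. UNIV))"
    using exp_neg_abs_summable
    by (intro abs_summable_on_prod_PiE) (auto simp: abs_summable_equivalent [symmetric])
  then have "(\<lambda>g::3 \<Rightarrow> int. \<Prod>i\<in>UNIV. exp (- \<bar>real_of_int (g i)\<bar>)) summable_on UNIV"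
    by (simp add: abs_summable_equivalent [symmetric] PiE_UNIV_domain abs_prod)
  moreover have "bij_betw (\<lambda>n::int^3. vec_nth n) UNIV UNIV"
    by (metis bij_betw_def inj_def surj_def vec_lambda_inverse vec_nth_inject UNIV_I)
  ultimately have "(\<lambda>n::int^3. \<Prod>i\<in>UNIV. exp (- \<bar>real_of_int (n $ i)\<bar>)) summable_on UNIV"
    using summable_on_reindex_bij_betw[of vec_nth UNIV UNIV
        "\<lambda>g::3 \<Rightarrow> int. \<Prod>i\<in>UNIV. exp (- \<bar>real_of_int (g i)\<bar>)"] by simp
  then show ?thesis
    by (simp add: exp_sum [symmetric] sum_negf)
qed

text \<open>Compactness of the unit sphere yields a positive minimum \<open>m\<close>, and
  homogeneity of degree two extends the bound to all vectors.\<close>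

lemma pos_def_lower_bound:
  assumes "pos_def_mat R"
  obtains m where "m > 0" "\<And>v. m * (norm v)\<^sup>2 \<le> qform R v"
proof -
  have "continuous_on (sphere 0 1) (qform R)"
    unfolding qform_def by (intro continuous_intros linear_continuous_on)
      (simp add: matrix_vector_mul_bounded_linear)
  moreover have "sphere (0 :: real^3) 1 \<noteq> {}"
    using sphere_eq_empty[of "0 :: real^3" 1] by simp
  ultimately obtain u where u: "u \<in> sphere 0 1" "\<And>v. v \<in> sphere 0 1 \<Longrightarrow> qform R u \<le> qform R v"
    using continuous_attains_inf[OF compact_sphere] by metis
  have "qform R u * (norm v)\<^sup>2 \<le> qform R v" for v
  proof (cases "v = 0")
    case False
    let ?w = "(1 / norm v) *\<^sub>R v"
    have "qform R ?w * (norm v)\<^sup>2 = qform R v"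
      using False by (simp add: qform_def matrix_vector_mult_scaleR power2_eq_square)
    moreover have "qform R u \<le> qform R ?w"
      using False by (intro u) simp
    ultimately show ?thesis
      by (metis mult_right_mono zero_le_power2)
  qed (simp add: qform_def)
  moreover have "qform R u > 0"
  proof -
    have "u \<noteq> 0" using u(1) by auto
    then show ?thesis using assms by (simp add: pos_def_mat_def qform_def)
  qed
  ultimately show ?thesis by (intro that)
qed

lemma Re_cdot_mat: "Re (cdot (complex_vec v) (M *v complex_vec v)) = qform (Re_mat M) v"
  by (simp add: cdot_def qform_def inner_vec_def matrix_vector_mult_def)

lemma Im_cdot: "Im (cdot (complex_vec v) x) = v \<bullet> (\<chi> i. Im (x $ i))"
  by (simp add: cdot_def inner_vec_def)

lemma norm_theta_term:
  "norm (theta_term x M n) =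
     exp (- pi * qform (Re_mat M) (real_vec n) - 2 * pi * (real_vec n \<bullet> (\<chi> i. Im (x $ i))))"
proof -
  let ?m = "complex_vec (real_vec n)"
  have "Re (2 * of_real pi * (- (1/2) * cdot ?m (M *v ?m) + \<i> * cdot ?m x)) =
      - pi * Re (cdot ?m (M *v ?m)) - 2 * pi * Im (cdot ?m x)"
    by (simp add: algebra_simps)
  then show ?thesis
    unfolding theta_term_def Let_def ee_def norm_exp_eq_Re Re_cdot_mat Im_cdot by simp
qed

text \<open>The Gaussian decay of the quadratic term absorbs the exponential growth caused by the
  imaginary part of \<open>x\<close>.\<close>

lemma theta_term_summable:
  assumes "pos_def_mat (Re_mat M)"
  shows "(\<lambda>n. norm (theta_term x M n)) summable_on UNIV"
proof -
  obtain m where m: "m > 0" "\<And>v. m * (norm v)\<^sup>2 \<le> qform (Re_mat M) v"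
    using pos_def_lower_bound[OF assms] by blast
  define y where "y = (\<chi> i. Im (x $ i))"
  \<comment> \<open>The first summand of \<open>b\<close> bounds the linear term in the exponent;
    the 3 pays for the l1 norm, which is at most three times the Euclidean norm. The constant
    \<open>C\<close> is the maximum of b r - pi m r^2 over real r.\<close>
  define b where "b = 2 * pi * norm y + 3"
  define C where "C = b\<^sup>2 / (4 * (pi * m))"
  have complete_square: "(2 * c * r - b)\<^sup>2 / (4 * c) = c * r\<^sup>2 - b * r + b\<^sup>2 / (4 * c)" if "c > 0" for c r
    using that by (simp add: power2_eq_square field_simps)
  have bound: "norm (theta_term x M n) \<le> exp C * exp (- (\<Sum>i\<in>UNIV. \<bar>real_of_int (n $ i)\<bar>))" for n
  proof -
    let ?r = "norm (real_vec n)"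
    have pm: "pi * m > 0" using m by simp
    have "- pi * qform (Re_mat M) (real_vec n) \<le> - (pi * m) * ?r\<^sup>2"
      using m(2)[of "real_vec n"] by (simp add: mult.assoc)
    moreover have "- (real_vec n \<bullet> y) \<le> ?r * norm y"
      using Cauchy_Schwarz_ineq2[of "real_vec n" y] by linarith
    then have "2 * pi * - (real_vec n \<bullet> y) \<le> 2 * pi * (?r * norm y)"
      by (intro mult_left_mono) auto
    moreover have "(\<Sum>i\<in>UNIV. \<bar>real_of_int (n $ i)\<bar>) \<le> (\<Sum>i\<in>(UNIV :: 3 set). ?r)"
      using component_le_norm_cart[of "real_vec n"] by (intro sum_mono) auto
    then have "(\<Sum>i\<in>UNIV. \<bar>real_of_int (n $ i)\<bar>) \<le> 3 * ?r" by simp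
    moreover have "b * ?r \<le> pi * m * ?r\<^sup>2 + C"
    proof -
      have "0 \<le> (2 * (pi * m) * ?r - b)\<^sup>2 / (4 * (pi * m))" using pm by simp
      also have "\<dots> = (pi * m) * ?r\<^sup>2 - b * ?r + C"
        unfolding C_def using complete_square[OF pm] by simp
      finally show ?thesis by linarith
    qed
    moreover have "b * ?r = 2 * pi * (?r * norm y) + 3 * ?r"
      by (simp add: b_def distrib_right mult.assoc mult.commute[of "norm y"])
    moreover have "2 * pi * - (real_vec n \<bullet> y) = - (2 * pi * (real_vec n \<bullet> y))"
      by simp
    moreover have "- (pi * m) * ?r\<^sup>2 = - (pi * m * ?r\<^sup>2)"
      by simp
    ultimately have "- pi * qform (Re_mat M) (real_vec n) - 2 * pi * (real_vec n \<bullet> y)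
        \<le> C - (\<Sum>i\<in>UNIV. \<bar>real_of_int (n $ i)\<bar>)"
      by linarith
    then show ?thesis
      unfolding norm_theta_term y_def [symmetric] by (simp add: exp_add [symmetric])
  qed
  show ?thesis
    by (rule summable_on_comparison_test[OF summable_on_cmult_right[OF exp_neg_abs_summable_lattice]])
      (use bound in auto)
qed

section \<open>The damping of a single term under the degeneration\<close>

lemma symmetric_inner_mult:
  fixes B :: "real^3^3"
  assumes "transpose B = B"
  shows "v \<bullet> (B *v w) = w \<bullet> (B *v v)"
  by (metis assms dot_lmul_matrix inner_commute transpose_matrix_vector)

lemma qform_diff:
  assumes "transpose B = B"
  shows "qform B (a - v) = qform B a - 2 * (v \<bullet> (B *v a)) + qform B v"
  using symmetric_inner_mult[OF assms, of a v]
  by (simp add: qform_def matrix_vector_mult_diff_distrib inner_diff_left inner_diff_right)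

lemma cdot_mat_add: "cdot v ((M + N) *v w) = cdot v (M *v w) + cdot v (N *v w)"
  by (simp add: cdot_def matrix_vector_mult_def sum.distrib algebra_simps)

lemma cdot_mat_real:
  "cdot (complex_vec v) ((t *\<^sub>R complex_mat B) *v complex_vec w) = of_real (t * (v \<bullet> (B *v w)))"
proof -
  have "(t *\<^sub>R complex_mat B) $ i $ j = of_real (t * B $ i $ j)" for i j
    by (simp add: complex_eq_iff)
  then show ?thesis
    by (simp add: cdot_def matrix_vector_mult_def inner_vec_def sum_distrib_left mult_ac)
qed

lemma cdot_shift: "cdot m (x - c *s complex_vec v) = cdot m x - c * cdot m (complex_vec v)"
  by (simp add: cdot_def sum_subtractf sum_distrib_left algebra_simps)

lemma cdot_real: "cdot (complex_vec v) (complex_vec w) = of_real (v \<bullet> w)"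
  by (simp add: cdot_def inner_vec_def)

text \<open>In the exponent, the shift of the argument contributes \<open>t\<close> times the
  product of \<open>n\<close> with \<open>B a\<close>, and the matrix \<open>t B\<close> contributes
  -t/2 times the form at \<open>n\<close>. By \<open>qform_diff\<close> they combine into a real
  factor.\<close>

lemma theta_term_degeneration:
  assumes "transpose B = B"
  shows "theta_term (x - (\<i> * complex_of_real t) *s complex_vec (B *v a)) (t *\<^sub>R complex_mat B + M) n =
    of_real (exp (- (pi * (qform B (a - real_vec n) - qform B a)) * t)) * theta_term x M n"
proof -
  let ?m = "complex_vec (real_vec n)"
  let ?p = "complex_of_real (real_vec n \<bullet> (B *v a))" and ?q = "complex_of_real (qform B (real_vec n))"
  have *: "- (1/2) * cdot ?m ((t *\<^sub>R complex_mat B + M) *v ?m)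
      + \<i> * cdot ?m (x - (\<i> * complex_of_real t) *s complex_vec (B *v a))
    = - (1/2) * cdot ?m (M *v ?m) + \<i> * cdot ?m x - of_real t * (?q / 2 - ?p)"
    by (simp only: cdot_mat_add cdot_mat_real cdot_shift cdot_real qform_def)
      (simp add: algebra_simps)
  have **: "- (pi * (qform B (a - real_vec n) - qform B a)) * t
      = 2 * pi * (- t * (qform B (real_vec n) / 2 - real_vec n \<bullet> (B *v a)))"
    unfolding qform_diff[OF assms] by (simp add: algebra_simps)
  show ?thesis
    unfolding theta_term_def Let_def ee_def * ** exp_of_real [symmetric] exp_add [symmetric]
    by (simp add: algebra_simps)
qed

text \<open>Dominated convergence: the term of \<open>n\<close> is damped by
  \<open>exp (- \<pi> t (q (a - n) - q a))\<close>, where \<open>q (a - n) \<ge> q a\<close> with equality on the Delaunay set.\<close>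

lemma theta_degeneration:
  assumes "transpose B = B" "pos_def_mat (Re_mat M)" "a \<in> voronoi_cell B" "finite (delaunay_set B a)"
  shows "((\<lambda>t :: real. riemann_theta (x - (\<i> * complex_of_real t) *s complex_vec (B *v a))
            (t *\<^sub>R complex_mat B + M))
          \<longlongrightarrow> (\<Sum>n\<in>delaunay_set B a. theta_term x M n)) at_top"
proof -
  define \<delta> where "\<delta> n = pi * (qform B (a - real_vec n) - qform B a)" for n
  define s where "s t n = of_real (exp (- \<delta> n * t)) * theta_term x M n" for t n
  define f where "f n = (if n \<in> delaunay_set B a then theta_term x M n else 0)" for n
  have \<delta>: "\<delta> n \<ge> 0" "\<delta> n = 0 \<longleftrightarrow> n \<in> delaunay_set B a" for n
    using assms(3) by (auto simp: \<delta>_def voronoi_cell_def delaunay_set_def)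
  have bound: "norm (s t n) \<le> norm (theta_term x M n)" if "t \<ge> 0" for t n
    using that \<delta>[of n] by (simp add: s_def norm_mult mult_left_le_one_le)
  have summ: "(\<lambda>n. norm (theta_term x M n)) summable_on UNIV"
    by (rule theta_term_summable[OF assms(2)])
  \<comment> \<open>The series is read as an integral over the counting measure of the lattice; the
    undamped terms are the integrable majorant.\<close>
  then have int: "integrable (count_space UNIV) (\<lambda>n. norm (theta_term x M n))"
    using abs_summable_equivalent[of "\<lambda>n. norm (theta_term x M n)" UNIV]
    by (simp add: abs_summable_on_def)
  have lim: "((\<lambda>t. s t n) \<longlongrightarrow> f n) at_top" for n
  proof (cases "n \<in> delaunay_set B a")
    case True
    then show ?thesis using \<delta>(2)[of n] by (simp add: s_def f_def)
  next
    case False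
    then have "\<delta> n > 0" using \<delta>[of n] by linarith
    then have "((\<lambda>t. exp (- \<delta> n * t)) \<longlongrightarrow> 0) at_top"
      by (intro filterlim_compose[OF exp_at_bot] filterlim_tendsto_neg_mult_at_bot[OF tendsto_const _ filterlim_ident])
         simp
    then have "((\<lambda>t. complex_of_real (exp (- \<delta> n * t)) * theta_term x M n) \<longlongrightarrow> of_real 0 * theta_term x M n) at_top"
      by (intro tendsto_intros)
    then show ?thesis using False by (simp add: s_def f_def)
  qed
  have "((\<lambda>t. integral\<^sup>L (count_space UNIV) (s t)) \<longlongrightarrow> integral\<^sup>L (count_space UNIV) f) at_top"
    by (rule integral_dominated_convergence_at_top[OF _ _ int])
      (use lim bound in \<open>auto intro: eventually_mono[OF eventually_ge_at_top[of 0]]\<close>)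
  moreover have "integral\<^sup>L (count_space UNIV) f = (\<Sum>n\<in>delaunay_set B a. theta_term x M n)"
    using assms(4)
    by (subst lebesgue_integral_count_space_finite_support) (auto simp: f_def intro!: sum.mono_neutral_cong_left)
  moreover have "\<forall>\<^sub>F t in at_top. integral\<^sup>L (count_space UNIV) (s t) =
      riemann_theta (x - (\<i> * complex_of_real t) *s complex_vec (B *v a)) (t *\<^sub>R complex_mat B + M)"
    using eventually_ge_at_top[of 0]
  proof eventually_elim
    case (elim t)
    \<comment> \<open>Damping keeps the series absolutely convergent, so that \<open>infsum\<close>
      agrees with the integral.\<close>
    have "(\<lambda>n. norm (s t n)) summable_on UNIV"
      by (rule summable_on_comparison_test[OF summ]) (use bound elim in auto)
    then have "Infinite_Set_Sum.abs_summable_on (s t) UNIV"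
      by (simp add: abs_summable_equivalent [symmetric])
    then have "integral\<^sup>L (count_space UNIV) (s t) = infsum (s t) UNIV"
      using infsetsum_infsum[of "s t" UNIV] by (simp add: infsetsum_def)
    moreover have "s t = theta_term (x - (\<i> * complex_of_real t) *s complex_vec (B *v a)) (t *\<^sub>R complex_mat B + M)"
      unfolding s_def \<delta>_def theta_term_degeneration[OF assms(1)] ..
    ultimately show ?case by (simp only: riemann_theta_def)
  qed
  ultimately show ?thesis
    using tendsto_cong by force
qed

section \<open>Voronoi cells of unimodular systems\<close>

text \<open>The hypothesis \<open>conformal\<close> expresses unimodularity: together with
  \<open>integral\<close>, every real vector is a nonnegative combination of lattice vectors on
  which the forms take the values -1, 0, 1, without cancellation in any form. The hypothesis
  \<open>faithful\<close> makes the Gram matrix definite.\<close>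

locale dicing =
  fixes w :: "nat \<Rightarrow> real^3" and m :: nat and B :: "real^3^3"
  assumes gram: "B *v v = (\<Sum>k<m. (w k \<bullet> v) *\<^sub>R w k)"
    and faithful: "(\<And>k. k < m \<Longrightarrow> w k \<bullet> v = 0) \<Longrightarrow> v = 0"
    and nonzero: "k < m \<Longrightarrow> w k \<noteq> 0"
    and integral: "k < m \<Longrightarrow> w k \<bullet> real_vec n \<in> \<int>"
    and conformal: "\<exists>c N r. v = (\<Sum>l<r. c l *\<^sub>R real_vec (N l)) \<and>
      (\<forall>l<r. 0 \<le> c l \<and> (\<forall>k<m. \<bar>w k \<bullet> real_vec (N l)\<bar> \<le> 1)) \<and>
      (\<forall>k<m. \<bar>w k \<bullet> v\<bar> = (\<Sum>l<r::nat. c l * \<bar>w k \<bullet> real_vec (N l)\<bar>))"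
begin

lemma inner_gram: "v \<bullet> (B *v u) = (\<Sum>k<m. (w k \<bullet> v) * (w k \<bullet> u))"
  unfolding gram by (simp add: inner_sum_right inner_commute mult.commute)

lemma qform_eq: "qform B v = (\<Sum>k<m. (w k \<bullet> v)\<^sup>2)"
  unfolding qform_def inner_gram by (simp add: power2_eq_square)

lemma gram_symmetric: "transpose B = B"
proof -
  have "B $ i $ j = axis i 1 \<bullet> (B *v axis j 1)" for i j
    by (simp add: inner_axis' matrix_vector_mult_basis column_def)
  then have "B $ i $ j = B $ j $ i" for i j
    unfolding inner_gram by (simp add: mult.commute)
  then show ?thesis by (simp add: transpose_def vec_eq_iff)
qed

lemma gram_mult_eq_0_iff: "B *v v = 0 \<longleftrightarrow> v = 0"
proof
  assume "B *v v = 0"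
  then have "qform B v = 0" by (simp add: qform_def)
  then have "w k \<bullet> v = 0" if "k < m" for k
    using that by (simp add: qform_eq sum_nonneg_eq_0_iff)
  then show "v = 0" by (rule faithful)
qed simp

lemma gram_mult_surj: obtains u where "B *v u = v"
proof -
  have "inj ((*v) B)"
    by (rule linear_injective_0[OF matrix_vector_mul_linear, THEN iffD2]) (simp add: gram_mult_eq_0_iff)
  then have "surj ((*v) B)"
    using linear_injective_imp_surjective[OF matrix_vector_mul_linear] by blast
  then show ?thesis using that by (metis surjD)
qed

text \<open>A representation of \<open>2 B a\<close> splits the Voronoi inequality into one term per
  form, whose signs can be studied separately.\<close>

lemma slack:
  assumes "2 *\<^sub>R (B *v a) = (\<Sum>k<m. s k *\<^sub>R w k)"
  shows "qform B (a - v) - qform B a = (\<Sum>k<m. (w k \<bullet> v) * (w k \<bullet> v - s k))"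
proof -
  have "2 * (v \<bullet> (B *v a)) = v \<bullet> (2 *\<^sub>R (B *v a))" by simp
  also have "\<dots> = (\<Sum>k<m. s k * (w k \<bullet> v))"
    unfolding assms by (simp add: inner_sum_right inner_commute)
  finally have "qform B (a - v) - qform B a = (\<Sum>k<m. (w k \<bullet> v)\<^sup>2) - (\<Sum>k<m. s k * (w k \<bullet> v))"
    using qform_diff[OF gram_symmetric, of a v] qform_eq[of v] by linarith
  then show ?thesis
    by (simp add: sum_subtractf [symmetric] algebra_simps power2_eq_square)
qed

text \<open>The product is negative only for \<open>x\<close> strictly between 0 and
  \<open>s\<close>, where no integer lies.\<close>

lemma slack_term_nonneg:
  fixes x s :: real
  assumes "x \<in> \<int>" "\<bar>s\<bar> \<le> 1"
  shows "0 \<le> x * (x - s)"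
proof -
  obtain i where i: "x = of_int i" using assms(1) by (auto elim: Ints_cases)
  consider "i = 0" | "i \<ge> 1" | "i \<le> -1" by linarith
  then show ?thesis
  proof cases
    case 2
    then have "x \<ge> 1" by (simp add: i)
    then show ?thesis using assms(2) by simp
  next
    case 3
    then have "x \<le> -1" by (simp add: i)
    then show ?thesis using assms(2) by (simp add: mult_nonpos_nonpos)
  qed (simp add: i)
qed

lemma mem_voronoi_cell_iff:
  "a \<in> voronoi_cell B \<longleftrightarrow> (\<forall>n. 2 * (real_vec n \<bullet> (B *v a)) \<le> qform B (real_vec n))"
  by (simp add: voronoi_cell_def qform_diff[OF gram_symmetric])

text \<open>If \<open>2 B a\<close> were outside the zonotope, a hyperplane would separate it from the point of the
  zonotope that maximises a linear form \<open>v\<close>; the maximum is \<open>\<Sum>k<m. \<bar>w k \<bullet> v\<bar>\<close>. Decomposing \<open>v\<close>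
  conformally into lattice vectors on which all forms take values in \<open>{-1, 0, 1}\<close>, where
  \<open>\<bar>w k \<bullet> n\<bar> = (w k \<bullet> n)\<^sup>2\<close>, the Voronoi inequalities bound \<open>2 v \<bullet> B a\<close> by this maximum.\<close>

lemma voronoi_cell_eq_zonotope:
  "a \<in> voronoi_cell B \<longleftrightarrow>
     (\<exists>s. (\<forall>k<m. \<bar>s k\<bar> \<le> 1) \<and> 2 *\<^sub>R (B *v a) = (\<Sum>k<m. s k *\<^sub>R w k))"
proof
  assume "\<exists>s. (\<forall>k<m. \<bar>s k\<bar> \<le> 1) \<and> 2 *\<^sub>R (B *v a) = (\<Sum>k<m. s k *\<^sub>R w k)"
  then obtain s where s: "\<And>k. k < m \<Longrightarrow> \<bar>s k\<bar> \<le> 1" "2 *\<^sub>R (B *v a) = (\<Sum>k<m. s k *\<^sub>R w k)"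
    by blast
  have "0 \<le> qform B (a - real_vec n) - qform B a" for n
    unfolding slack[OF s(2)] by (intro sum_nonneg slack_term_nonneg) (use s(1) integral in auto)
  then show "a \<in> voronoi_cell B" by (simp add: voronoi_cell_def)
next
  assume a: "a \<in> voronoi_cell B"
  define Z where "Z = {\<Sum>k<m. s k *\<^sub>R w k | s. \<forall>k<m. \<bar>s k\<bar> \<le> 1}"
  \<comment> \<open>The set \<open>S\<close> of sign combinations is finite, so its convex hull is
    closed and can be strictly separated from an outside point; by convexity this hull lies in the
    zonotope \<open>Z\<close>.\<close>
  define S where "S = (\<lambda>s. \<Sum>k<m. s k *\<^sub>R w k) ` PiE {..<m} (\<lambda>_. {-1, 1})"
  have "convex Z"
    unfolding convex_def
  proof (intro ballI allI impI)
    fix x y and u v :: real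
    assume uv: "0 \<le> u" "0 \<le> v" "u + v = 1" and xy: "x \<in> Z" "y \<in> Z"
    then obtain s t where s: "\<And>k. k < m \<Longrightarrow> \<bar>s k\<bar> \<le> 1" "x = (\<Sum>k<m. s k *\<^sub>R w k)"
      and t: "\<And>k. k < m \<Longrightarrow> \<bar>t k\<bar> \<le> 1" "y = (\<Sum>k<m. t k *\<^sub>R w k)"
      unfolding Z_def by blast
    have "u *\<^sub>R x + v *\<^sub>R y = (\<Sum>k<m. (u * s k + v * t k) *\<^sub>R w k)"
      by (simp add: s t scaleR_sum_right sum.distrib scaleR_add_left)
    moreover have "\<bar>u * s k + v * t k\<bar> \<le> 1" if "k < m" for k
    proof -
      have "\<bar>u * s k + v * t k\<bar> \<le> u * \<bar>s k\<bar> + v * \<bar>t k\<bar>"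
        using uv by (metis abs_mult abs_of_nonneg abs_triangle_ineq)
      also have "\<dots> \<le> u * 1 + v * 1"
        using uv s(1)[OF that] t(1)[OF that] by (intro add_mono mult_left_mono) auto
      finally show ?thesis using uv by simp
    qed
    ultimately show "u *\<^sub>R x + v *\<^sub>R y \<in> Z"
      unfolding Z_def by (intro CollectI exI[of _ "\<lambda>k. u * s k + v * t k"]) auto
  qed
  moreover have "S \<subseteq> Z"
  proof
    fix z assume "z \<in> S"
    then obtain s where s: "s \<in> PiE {..<m} (\<lambda>_. {-1, 1})" "z = (\<Sum>k<m. s k *\<^sub>R w k)"
      unfolding S_def by blast
    have "\<bar>s k\<bar> \<le> 1" if "k < m" for k
      using PiE_mem[OF s(1), of k] that by auto
    then show "z \<in> Z" unfolding Z_def using s(2) by blast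
  qed
  ultimately have hull: "convex hull S \<subseteq> Z" by (simp add: hull_minimal)
  have "2 *\<^sub>R (B *v a) \<in> convex hull S"
  proof (rule ccontr)
    assume "\<not> ?thesis"
    moreover have "finite S" unfolding S_def by (intro finite_imageI finite_PiE) auto
    then have "closed (convex hull S)"
      by (simp add: compact_imp_closed finite_imp_compact_convex_hull)
    ultimately obtain v' b where sep: "v' \<bullet> (2 *\<^sub>R (B *v a)) < b" "\<And>z. z \<in> convex hull S \<Longrightarrow> v' \<bullet> z > b"
      using separating_hyperplane_closed_point[OF convex_convex_hull] by metis
    define v where "v = - v'"
    \<comment> \<open>These signs maximise the linear form \<open>v\<close> over \<open>S\<close>;
      where a form vanishes at \<open>v\<close>, the choice is immaterial.\<close>
    define s where "s = restrict (\<lambda>k. if w k \<bullet> v \<ge> 0 then 1 else -1 :: real) {..<m}"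
    have "s \<in> PiE {..<m} (\<lambda>_. {-1, 1})" unfolding s_def by auto
    then have "(\<Sum>k<m. s k *\<^sub>R w k) \<in> S" unfolding S_def by (rule image_eqI[OF refl])
    then have "b < v' \<bullet> (\<Sum>k<m. s k *\<^sub>R w k)" by (intro sep(2) hull_inc)
    then have "v \<bullet> (\<Sum>k<m. s k *\<^sub>R w k) < v \<bullet> (2 *\<^sub>R (B *v a))"
      using sep(1) unfolding v_def inner_minus_left by linarith
    moreover have "v \<bullet> (\<Sum>k<m. s k *\<^sub>R w k) = (\<Sum>k<m. \<bar>w k \<bullet> v\<bar>)"
      unfolding inner_sum_right
      by (rule sum.cong) (auto simp: s_def inner_commute[of v])
    moreover have "v \<bullet> (2 *\<^sub>R (B *v a)) \<le> (\<Sum>k<m. \<bar>w k \<bullet> v\<bar>)"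
    proof -
      obtain c N r where cN: "v = (\<Sum>l<r. c l *\<^sub>R real_vec (N l))"
        "\<And>l. l < r \<Longrightarrow> 0 \<le> c l" "\<And>l k. l < r \<Longrightarrow> k < m \<Longrightarrow> \<bar>w k \<bullet> real_vec (N l)\<bar> \<le> 1"
        "\<And>k. k < m \<Longrightarrow> \<bar>w k \<bullet> v\<bar> = (\<Sum>l<r::nat. c l * \<bar>w k \<bullet> real_vec (N l)\<bar>)"
        using conformal[of v] by blast
      have "v \<bullet> (2 *\<^sub>R (B *v a)) = (\<Sum>l<r. c l * (2 * (real_vec (N l) \<bullet> (B *v a))))"
        by (subst cN(1)) (simp add: inner_sum_left sum_distrib_left mult_ac)
      also have "\<dots> \<le> (\<Sum>l<r. c l * (\<Sum>k<m. \<bar>w k \<bullet> real_vec (N l)\<bar>))"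
      proof (intro sum_mono mult_left_mono)
        fix l assume l: "l \<in> {..<r}"
        have "2 * (real_vec (N l) \<bullet> (B *v a)) \<le> (\<Sum>k<m. (w k \<bullet> real_vec (N l))\<^sup>2)"
          using a by (simp only: mem_voronoi_cell_iff qform_eq)
        also have "\<dots> \<le> (\<Sum>k<m. \<bar>w k \<bullet> real_vec (N l)\<bar>)"
        proof (intro sum_mono)
          fix k assume "k \<in> {..<m}"
          then have "\<bar>w k \<bullet> real_vec (N l)\<bar> \<le> 1" using cN(3) l by auto
          then have "\<bar>w k \<bullet> real_vec (N l)\<bar> * \<bar>w k \<bullet> real_vec (N l)\<bar> \<le> \<bar>w k \<bullet> real_vec (N l)\<bar> * 1"
            by (intro mult_left_mono) auto
          then show "(w k \<bullet> real_vec (N l))\<^sup>2 \<le> \<bar>w k \<bullet> real_vec (N l)\<bar>"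
            by (simp add: power2_eq_square)
        qed
        finally show "2 * (real_vec (N l) \<bullet> (B *v a)) \<le> (\<Sum>k<m. \<bar>w k \<bullet> real_vec (N l)\<bar>)" .
      qed (use cN(2) in auto)
      also have "\<dots> = (\<Sum>k<m. \<bar>w k \<bullet> v\<bar>)"
        by (simp add: cN(4) sum_distrib_left) (rule sum.swap)
      finally show ?thesis .
    qed
    ultimately show False by linarith
  qed
  with hull have "2 *\<^sub>R (B *v a) \<in> Z" by blast
  then show "\<exists>s. (\<forall>k<m. \<bar>s k\<bar> \<le> 1) \<and> 2 *\<^sub>R (B *v a) = (\<Sum>k<m. s k *\<^sub>R w k)"
    unfolding Z_def by blast
qed

text \<open>A coefficient strictly between -1 and 1 could be moved both ways. This would move
  \<open>a\<close> in both directions along a segment inside the cell.\<close>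

lemma extreme_coefficients:
  assumes "a extreme_point_of voronoi_cell B"
    and s: "\<And>k. k < m \<Longrightarrow> \<bar>s k\<bar> \<le> 1" "2 *\<^sub>R (B *v a) = (\<Sum>k<m. s k *\<^sub>R w k)"
    and j: "j < m"
  shows "\<bar>s j\<bar> = 1"
proof (rule ccontr)
  assume "\<bar>s j\<bar> \<noteq> 1"
  define \<epsilon> where "\<epsilon> = 1 - \<bar>s j\<bar>"
  have \<epsilon>: "\<epsilon> > 0" using s(1)[OF j] \<open>\<bar>s j\<bar> \<noteq> 1\<close> by (simp add: \<epsilon>_def)
  \<comment> \<open>The half compensates the factor 2 in the representation, so that a step by
    \<open>u\<close> changes \<open>s j\<close> by exactly \<open>\<epsilon>\<close>.\<close>
  obtain u where u: "B *v u = (\<epsilon> / 2) *\<^sub>R w j" by (rule gram_mult_surj)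
  have "u \<noteq> 0" using u \<epsilon> nonzero[OF j] by auto
  have mem: "a + c *\<^sub>R u \<in> voronoi_cell B" if c: "\<bar>c\<bar> = 1" for c
  proof -
    have "2 *\<^sub>R (B *v (a + c *\<^sub>R u)) = (\<Sum>k<m. s k *\<^sub>R w k) + (c * \<epsilon>) *\<^sub>R w j"
      by (simp add: matrix_vector_right_distrib matrix_vector_mult_scaleR scaleR_add_right s(2) u)
    also have "\<dots> = (\<Sum>k<m. (s k + (if k = j then c * \<epsilon> else 0)) *\<^sub>R w k)"
      using j by (simp add: scaleR_add_left sum.distrib if_distrib[of "\<lambda>x. x *\<^sub>R _"] sum.delta cong: if_cong)
    finally have "2 *\<^sub>R (B *v (a + c *\<^sub>R u)) = (\<Sum>k<m. (s k + (if k = j then c * \<epsilon> else 0)) *\<^sub>R w k)" .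
    moreover have "\<bar>s k + (if k = j then c * \<epsilon> else 0)\<bar> \<le> 1" if "k < m" for k
    proof (cases "k = j")
      case True
      have "\<bar>s j + c * \<epsilon>\<bar> \<le> \<bar>s j\<bar> + \<bar>c\<bar> * \<epsilon>"
        using abs_triangle_ineq[of "s j" "c * \<epsilon>"] \<epsilon> by (simp add: abs_mult)
      then show ?thesis using True c by (simp add: \<epsilon>_def)
    qed (use s(1)[OF that] in simp)
    ultimately show ?thesis
      unfolding voronoi_cell_eq_zonotope
      by (intro exI[of _ "\<lambda>k. s k + (if k = j then c * \<epsilon> else 0)"]) blast
  qed
  have "a + u \<in> voronoi_cell B" "a - u \<in> voronoi_cell B"
    using mem[of 1] mem[of "-1"] by auto
  moreover have "a \<in> open_segment (a - u) (a + u)"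
  proof -
    have "a - u \<noteq> a + u"
    proof
      assume "a - u = a + u"
      then have "u = - u" by simp
      with \<open>u \<noteq> 0\<close> show False by (simp add: eq_neg_iff_add_eq_0 flip: scaleR_2)
    qed
    moreover have "a = (1 - 1/2) *\<^sub>R (a - u) + (1/2) *\<^sub>R (a + u)"
      using scaleR_half_double[of a] by (simp flip: scaleR_add_right)
    ultimately show ?thesis unfolding in_segment by (intro conjI exI[of _ "1/2"]) auto
  qed
  ultimately show False using assms(1) unfolding extreme_point_of_def by blast
qed

text \<open>All summands in \<open>slack\<close> are nonnegative at lattice points, so equality in
  the Voronoi inequality forces each of them to vanish.\<close>

lemma delaunay_set_eq:
  assumes s: "\<And>k. k < m \<Longrightarrow> \<bar>s k\<bar> \<le> 1" "2 *\<^sub>R (B *v a) = (\<Sum>k<m. s k *\<^sub>R w k)"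
  shows "delaunay_set B a = {n. \<forall>k<m. w k \<bullet> real_vec n = 0 \<or> w k \<bullet> real_vec n = s k}"
proof -
  have "n \<in> delaunay_set B a \<longleftrightarrow> (\<Sum>k<m. (w k \<bullet> real_vec n) * (w k \<bullet> real_vec n - s k)) = 0" for n
    unfolding slack[OF s(2), symmetric] by (auto simp: delaunay_set_def)
  also have "\<dots> n \<longleftrightarrow> (\<forall>k<m. (w k \<bullet> real_vec n) * (w k \<bullet> real_vec n - s k) = 0)" for n
    by (subst sum_nonneg_eq_0_iff) (use s(1) integral in \<open>auto intro!: slack_term_nonneg\<close>)
  finally show ?thesis by auto
qed

text \<open>The inequality of a Delaunay point is an equality at \<open>a\<close>, hence at both
  ends of any segment of the cell through \<open>a\<close>. If these points span, the two ends
  coincide.\<close>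

lemma extreme_if_delaunay_set_spanning:
  assumes a: "a \<in> voronoi_cell B"
    and span: "\<And>v. (\<And>n. n \<in> delaunay_set B a \<Longrightarrow> real_vec n \<bullet> v = 0) \<Longrightarrow> v = 0"
  shows "a extreme_point_of voronoi_cell B"
  unfolding extreme_point_of_def
proof (intro conjI ballI notI)
  fix p q assume pq: "p \<in> voronoi_cell B" "q \<in> voronoi_cell B" and "a \<in> open_segment p q"
  then obtain u where u: "p \<noteq> q" "0 < u" "u < 1" "a = (1 - u) *\<^sub>R p + u *\<^sub>R q"
    by (auto simp: in_segment)
  have "real_vec n \<bullet> (B *v (p - q)) = 0" if n: "n \<in> delaunay_set B a" for n
  proof -
    \<comment> \<open>The slack at \<open>v\<close> of the Voronoi inequality of \<open>n\<close>,
      an affine function of \<open>v\<close>.\<close>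
    let ?f = "\<lambda>v. qform B (real_vec n) - 2 * (real_vec n \<bullet> (B *v v))"
    have "?f p \<ge> 0" "?f q \<ge> 0"
      using pq unfolding mem_voronoi_cell_iff by auto
    moreover have "(1 - u) * ?f p + u * ?f q = 0"
    proof -
      have "(1 - u) * ?f p + u * ?f q = ?f a"
        unfolding u(4) by (simp add: matrix_vector_right_distrib matrix_vector_mult_scaleR inner_add_right algebra_simps)
      also have "\<dots> = 0" using n by (simp add: delaunay_set_def qform_diff[OF gram_symmetric])
      finally show ?thesis .
    qed
    ultimately have "?f p = 0" "?f q = 0"
      using u(2,3) by (smt (verit) mult_nonneg_nonneg mult_pos_pos)+
    then show ?thesis by (simp add: matrix_vector_mult_diff_distrib inner_diff_right)
  qed
  then have "B *v (p - q) = 0" by (rule span)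
  then show False using u(1) by (simp add: gram_mult_eq_0_iff)
qed (fact a)

end

section \<open>Potentials on the faces of the dual graph\<close>

text \<open>Potentials on the faces \<open>0, \<dots>, 3\<close> of the planar dual graph of the curve, normalised to vanish
  on the face \<open>0\<close>.\<close>

definition potential :: "'a::zero^3 \<Rightarrow> nat \<Rightarrow> 'a" where
  "potential v i = (if i = 0 then 0 else v $ of_nat i)"

text \<open>The entry type is general because integer potentials describe lattice points and flows,
  and real ones the ambient space.\<close>

definition edge_diff :: "nat \<times> nat \<Rightarrow> 'a::ab_group_add^3 \<Rightarrow> 'a" where
  "edge_diff e v = potential v (fst e) - potential v (snd e)"

definition edge_vec :: "nat \<times> nat \<Rightarrow> real^3" where
  "edge_vec e = (\<chi> r. edge_diff e (axis r 1))"

lemma potential_simps [simp]: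
  "potential v 0 = 0" "potential v (Suc 0) = v $ 1" "potential v 1 = v $ 1"
  "potential v 2 = v $ 2" "potential v 3 = v $ 3"
  by (simp_all add: potential_def)

lemma edge_diff_real_vec: "edge_diff e (real_vec n) = of_int (edge_diff e n)"
  by (simp add: edge_diff_def potential_def)

lemma edge_vec_inner: "edge_vec e \<bullet> v = edge_diff e v"
proof -
  have "(\<Sum>r\<in>UNIV. potential (axis r 1) i * v $ r) = potential v i" for i
    by (simp add: potential_def axis_def if_distrib[of "\<lambda>x. x * _"] sum.delta cong: if_cong)
  then show ?thesis
    by (simp add: edge_vec_def inner_vec_def edge_diff_def left_diff_distrib sum_subtractf)
qed

lemma edge_diff_linear:
  "edge_diff e (u - v) = edge_diff e u - edge_diff e (v :: 'a::ab_group_add^3)"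
  by (simp add: edge_diff_def potential_def)

lemma edge_diff_sum:
  fixes \<gamma> :: "'i \<Rightarrow> 'a::comm_ring_1^3"
  shows "edge_diff e (\<Sum>i\<in>A. c i *s \<gamma> i) = (\<Sum>i\<in>A. c i * edge_diff e (\<gamma> i))"
  by (simp add: edge_diff_def potential_def sum_subtractf right_diff_distrib)

text \<open>The indicator vectors of the upper level sets of the four values of the potential.\<close>

lemma potential_conformal_decomposition:
  fixes v :: "real^3"
  shows "\<exists>c (N :: nat \<Rightarrow> int^3). v = (\<Sum>l<3::nat. c l *\<^sub>R real_vec (N l)) \<and>
    (\<forall>l<3. 0 \<le> c l \<and> (\<forall>i<4. \<forall>j<4. \<bar>edge_diff (i,j) (N l)\<bar> \<le> 1)) \<and>
    (\<forall>i<4. \<forall>j<4.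
       \<bar>edge_diff (i,j) v\<bar> = (\<Sum>l<3. c l * \<bar>real_of_int (edge_diff (i,j) (N l))\<bar>))"
proof -
  let ?p = "potential v"
  \<comment> \<open>The negated key lists the faces by decreasing potential.\<close>
  define xs where "xs = sort_key (\<lambda>i. - ?p i) [0..<4]"
  have "length xs = 4" by (simp add: xs_def)
  then obtain i0 i1 i2 i3 where xs: "xs = [i0, i1, i2, i3]"
    by (auto simp: length_Suc_conv numeral_eq_Suc)
  have dist: "distinct [i0, i1, i2, i3]" using xs by (simp add: xs_def flip: xs)
  have "set [i0, i1, i2, i3] = {..<4}" using xs by (auto simp: xs_def simp flip: xs)
  then have set: "i < 4 \<longleftrightarrow> i = i0 \<or> i = i1 \<or> i = i2 \<or> i = i3" for i by auto
  have sorted: "?p i0 \<ge> ?p i1" "?p i1 \<ge> ?p i2" "?p i2 \<ge> ?p i3"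
    using sorted_sort_key[of "\<lambda>i. - ?p i" "[0..<4]"] unfolding xs_def [symmetric] xs by auto
  \<comment> \<open>\<open>h l\<close> is the indicator of the \<open>l + 1\<close> faces of highest
    potential, \<open>N l\<close> shifts it so as to vanish on face 0, and \<open>c l\<close> is the
    drop to the next value.\<close>
  define h :: "nat \<Rightarrow> nat \<Rightarrow> int" where "h l i = of_bool (i \<in> set (take (Suc l) xs))" for l i
  define N where "N l = (vector [h l 1 - h l 0, h l 2 - h l 0, h l 3 - h l 0] :: int^3)" for l
  define c where "c l = ?p (xs ! l) - ?p (xs ! Suc l)" for l
  have N: "potential (N l) i = h l i - h l 0" if "i < 4" for l i
  proof -
    from that consider "i = 0" | "i = 1" | "i = 2" | "i = 3" by linarith
    then show ?thesis by cases (simp_all add: N_def vector_3)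
  qed
  have sum3: "sum f {..<3} = f 0 + f 1 + f 2" for f :: "nat \<Rightarrow> real"
    by (simp add: numeral_eq_Suc)
  have h: "h 0 i0 = 1" "h 0 i1 = 0" "h 0 i2 = 0" "h 0 i3 = 0"
    "h 1 i0 = 1" "h 1 i1 = 1" "h 1 i2 = 0" "h 1 i3 = 0"
    "h 2 i0 = 1" "h 2 i1 = 1" "h 2 i2 = 1" "h 2 i3 = 0"
    using dist by (auto simp: h_def xs numeral_eq_Suc)
  have c: "c 0 \<ge> 0" "c 1 \<ge> 0" "c 2 \<ge> 0"
    using sorted by (simp_all add: c_def xs numeral_eq_Suc)
  have p': "?p i0 = ?p i3 + c 0 + c 1 + c 2" "?p i1 = ?p i3 + c 1 + c 2" "?p i2 = ?p i3 + c 2"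
    by (simp_all add: c_def xs numeral_eq_Suc)
  have p: "?p i = ?p i3 + (\<Sum>l<3. c l * of_int (h l i))" if "i < 4" for i
    using that[unfolded set] unfolding sum3 by (elim disjE) (simp_all add: h p' del: One_nat_def)
  \<comment> \<open>The level sets are nested: for fixed \<open>i\<close> and \<open>j\<close> the
    differences \<open>h l i - h l j\<close> never have opposite signs, so absolute values add
    up.\<close>
  have abs: "\<bar>?p i - ?p j\<bar> = (\<Sum>l<3. c l * \<bar>real_of_int (h l i - h l j)\<bar>)" if "i < 4" "j < 4" for i j
    using that[unfolded set] c unfolding sum3
    by (elim disjE) (simp_all add: h p' del: One_nat_def)
  show ?thesis
  proof (intro exI conjI allI impI)
    have "v $ r = (\<Sum>l<3. c l * real_of_int (N l $ r))" for r
    proof -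
      have "?p i = (\<Sum>l<3. c l * real_of_int (potential (N l) i))" if "i < 4" for i
        using p[OF that] p[of 0] by (simp add: N[OF that] right_diff_distrib sum_subtractf)
      from this[of 1] this[of 2] this[of 3] show ?thesis
        using exhaust_3[of r] by auto
    qed
    then show "v = (\<Sum>l<3. c l *\<^sub>R real_vec (N l))"
      by (simp add: vec_eq_iff)
    fix l :: nat assume "l < 3"
    then show "0 \<le> c l"
      using sorted by (auto simp: c_def xs less_Suc_eq numeral_eq_Suc)
    fix i j :: nat assume that: "i < 4" "j < 4"
    show "\<bar>edge_diff (i,j) (N l)\<bar> \<le> 1"
      by (simp add: edge_diff_def N that h_def)
  next
    fix i j :: nat assume that: "i < 4" "j < 4"
    show "\<bar>edge_diff (i,j) v\<bar> = (\<Sum>l<3. c l * \<bar>real_of_int (edge_diff (i,j) (N l))\<bar>)"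
      using abs[OF that] by (simp add: edge_diff_def N that)
  qed
qed

text \<open>The \<open>k\<close>-th entry of \<open>dual_edges T\<close> consists of the two faces, in an order given by the
  orientation, which are separated by the edge of the dual graph of the curve that joins the
  components in the \<open>k\<close>-th entry of \<open>primal_edges T\<close>.\<close>

fun primal_edges :: "quartic_type \<Rightarrow> (nat \<times> nat) list" where
  "primal_edges Irreducible_Quartic = [(0,0), (0,0), (0,0)]"
| "primal_edges Nodal_Cubic_And_Line = [(0,0), (0,1), (0,1), (0,1)]"
| "primal_edges Two_Conics = [(0,1), (0,1), (0,1), (0,1)]"
| "primal_edges Conic_And_Two_Lines = [(0,1), (0,1), (0,2), (0,2), (1,2)]"
| "primal_edges Four_Lines = [(0,1), (0,2), (0,3), (1,2), (1,3), (2,3)]"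

fun dual_edges :: "quartic_type \<Rightarrow> (nat \<times> nat) list" where
  "dual_edges Irreducible_Quartic = [(0,1), (0,2), (0,3)]"
| "dual_edges Nodal_Cubic_And_Line = [(0,3), (0,1), (1,2), (2,0)]"
| "dual_edges Two_Conics = [(0,1), (1,2), (2,3), (3,0)]"
| "dual_edges Conic_And_Two_Lines = [(0,1), (1,2), (2,3), (3,0), (0,2)]"
| "dual_edges Four_Lines = [(0,1), (1,2), (2,0), (3,1), (0,3), (3,2)]"

section \<open>Unimodularity of the five systems of forms\<close>

lemma length_primal_edges: "length (primal_edges T) = length (dual_edges T)"
  by (cases T) auto

lemma dual_edges_bounds:
  assumes "e \<in> set (dual_edges T)"
  shows "fst e < 4" "snd e < 4" "fst e \<noteq> snd e"
proof -
  have "list_all (\<lambda>e. fst e < 4 \<and> snd e < 4 \<and> fst e \<noteq> snd e) (dual_edges T)"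
    by (cases T) simp_all
  then show "fst e < 4" "snd e < 4" "fst e \<noteq> snd e"
    using assms by (auto simp: list_all_iff)
qed

text \<open>The dual edges connect all four faces, so the potential is constant, and it is zero on
  face 0.\<close>

lemma edge_diff_faithful:
  fixes v :: "'a::ab_group_add^3"
  assumes "\<And>e. e \<in> set (dual_edges T) \<Longrightarrow> edge_diff e v = 0"
  shows "v = 0"
proof -
  have "list_all (\<lambda>e. edge_diff e v = 0) (dual_edges T)"
    using assms by (simp add: list_all_iff)
  then have "v $ 1 = 0 \<and> v $ 2 = 0 \<and> v $ 3 = 0"
    by (cases T) (simp_all add: edge_diff_def)
  then show ?thesis by (simp add: vec_eq_iff forall_3)
qed

lemma edge_vec_nonzero:
  assumes "i < 4" "j < 4" "i \<noteq> j"
  shows "edge_vec (i, j) \<noteq> 0"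
proof -
  \<comment> \<open>This vector gives the faces the four distinct potentials 0, 1, 2, 3.\<close>
  have *: "potential (vector [1, 2, 3] :: real^3) i = real i" if "i < 4" for i
  proof -
    from that consider "i = 0" | "i = 1" | "i = 2" | "i = 3" by linarith
    then show ?thesis by cases (simp_all add: vector_3)
  qed
  have "edge_vec (i, j) \<bullet> vector [1, 2, 3] \<noteq> 0"
    using assms by (simp add: edge_vec_inner edge_diff_def *)
  then show ?thesis by auto
qed

text \<open>The Laplacian matrix of the planar dual graph with the row and column of face 0
  deleted.\<close>

definition dual_gram :: "quartic_type \<Rightarrow> real^3^3" where
  "dual_gram T = (\<chi> i j. \<Sum>k<length (dual_edges T). edge_vec (dual_edges T ! k) $ i * edge_vec (dual_edges T ! k) $ j)"

text \<open>The decomposition by level sets treats all pairs of faces at once, so it serves all five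
  types.\<close>

interpretation dual: dicing "\<lambda>k. edge_vec (dual_edges T ! k)" "length (dual_edges T)" "dual_gram T" for T
proof
  show "dual_gram T *v v = (\<Sum>k<length (dual_edges T). (edge_vec (dual_edges T ! k) \<bullet> v) *\<^sub>R edge_vec (dual_edges T ! k))" for v
  proof -
    have "(\<Sum>j\<in>UNIV. (\<Sum>k\<in>K. x k i * x k j) * v $ j) = (\<Sum>k\<in>K. (\<Sum>j\<in>UNIV. x k j * v $ j) * x k i)"
      for K :: "nat set" and x :: "nat \<Rightarrow> 3 \<Rightarrow> real" and i
      unfolding sum_distrib_right by (subst sum.swap) (simp add: mult_ac)
    from this[of "\<lambda>k i. edge_vec (dual_edges T ! k) $ i"] show ?thesis
      by (simp add: vec_eq_iff dual_gram_def matrix_vector_mult_def inner_vec_def)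
  qed
  show "v = 0" if "\<And>k. k < length (dual_edges T) \<Longrightarrow> edge_vec (dual_edges T ! k) \<bullet> v = 0" for v
    using that by (intro edge_diff_faithful[of T]) (metis edge_vec_inner in_set_conv_nth)
  show "edge_vec (dual_edges T ! k) \<noteq> 0" if "k < length (dual_edges T)" for k
    using edge_vec_nonzero[OF dual_edges_bounds[OF nth_mem[OF that]]] by simp
  show "edge_vec (dual_edges T ! k) \<bullet> real_vec n \<in> \<int>" for k n
    by (simp add: edge_vec_inner edge_diff_real_vec)
  show "\<exists>c N r. v = (\<Sum>l<r. c l *\<^sub>R real_vec (N l)) \<and>
      (\<forall>l<r. 0 \<le> c l \<and> (\<forall>k<length (dual_edges T). \<bar>edge_vec (dual_edges T ! k) \<bullet> real_vec (N l)\<bar> \<le> 1)) \<and>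
      (\<forall>k<length (dual_edges T). \<bar>edge_vec (dual_edges T ! k) \<bullet> v\<bar> =
         (\<Sum>l<r::nat. c l * \<bar>edge_vec (dual_edges T ! k) \<bullet> real_vec (N l)\<bar>))" for v
  proof -
    obtain c and N :: "nat \<Rightarrow> int^3" where cN:
      "v = (\<Sum>l<3::nat. c l *\<^sub>R real_vec (N l))" "\<And>l. l < 3 \<Longrightarrow> 0 \<le> c l"
      "\<And>i j l. \<lbrakk>i < 4; j < 4; l < 3\<rbrakk> \<Longrightarrow> \<bar>edge_diff (i,j) (N l)\<bar> \<le> 1"
      "\<And>i j. \<lbrakk>i < 4; j < 4\<rbrakk> \<Longrightarrow>
         \<bar>edge_diff (i,j) v\<bar> = (\<Sum>l<3. c l * \<bar>real_of_int (edge_diff (i,j) (N l))\<bar>)"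
      using potential_conformal_decomposition[of v] by blast
    have "\<bar>edge_vec (dual_edges T ! k) \<bullet> real_vec (N l)\<bar> \<le> 1"
      if "k < length (dual_edges T)" "l < 3" for k l
    proof -
      have "\<bar>edge_diff (dual_edges T ! k) (N l)\<bar> \<le> 1"
        using cN(3)[OF dual_edges_bounds(1,2)[OF nth_mem[OF that(1)]] that(2)] by simp
      then show ?thesis unfolding edge_vec_inner edge_diff_real_vec by linarith
    qed
    moreover have "\<bar>edge_vec (dual_edges T ! k) \<bullet> v\<bar> =
         (\<Sum>l<3. c l * \<bar>edge_vec (dual_edges T ! k) \<bullet> real_vec (N l)\<bar>)"
      if "k < length (dual_edges T)" for k
      using cN(4)[OF dual_edges_bounds(1,2)[OF nth_mem[OF that]]]
      by (simp add: edge_vec_inner edge_diff_real_vec)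
    ultimately show ?thesis
      using cN(1,2) by (intro exI[of _ c] exI[of _ N] exI[of _ 3]) blast
  qed
qed

section \<open>Enumeration of the Delaunay sets\<close>

text \<open>Not all cycles are listed, only enough of them for every orientation that is not acyclic to
  contain a listed one as a directed cycle.\<close>

fun dual_cycles :: "quartic_type \<Rightarrow> int list list" where
  "dual_cycles Irreducible_Quartic = []"
| "dual_cycles Nodal_Cubic_And_Line = [[0,1,1,1]]"
| "dual_cycles Two_Conics = [[1,1,1,1]]"
| "dual_cycles Conic_And_Two_Lines = [[1,1,0,0,-1], [0,0,1,1,1]]"
| "dual_cycles Four_Lines = [[1,1,1,0,0,0], [1,0,0,-1,-1,0], [0,0,1,0,1,1], [0,1,0,1,0,-1]]"

fun cell_sizes :: "quartic_type \<Rightarrow> nat list" where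
  "cell_sizes Irreducible_Quartic = [8]"
| "cell_sizes Nodal_Cubic_And_Line = [6]"
| "cell_sizes Two_Conics = [4, 6]"
| "cell_sizes Conic_And_Two_Lines = [4, 5]"
| "cell_sizes Four_Lines = [4]"

text \<open>Triples in place of vectors make the finite checks below executable.\<close>

fun triple_potential :: "int \<times> int \<times> int \<Rightarrow> nat \<Rightarrow> int" where
  "triple_potential (x, y, z) i = (if i = 0 then 0 else if i = 1 then x else if i = 2 then y else z)"

text \<open>A zero in \<open>\<kappa>\<close> marks an edge off the cycle, whose orientation is
  free.\<close>

definition agrees :: "int list \<Rightarrow> int list \<Rightarrow> bool" where
  "agrees \<kappa> \<sigma> \<longleftrightarrow> list_all2 (\<lambda>a b. a = 0 \<or> a = b) \<kappa> \<sigma>"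

definition cyclic_signs :: "quartic_type \<Rightarrow> int list \<Rightarrow> bool" where
  "cyclic_signs T \<sigma> \<longleftrightarrow>
     list_ex (\<lambda>\<kappa>. agrees \<kappa> \<sigma> \<or> agrees (map uminus \<kappa>) \<sigma>) (dual_cycles T)"

text \<open>For signs \<open>\<sigma>\<close> the bound 2 is large enough: the potential changes by
  at most 1 across an edge, and every face is at most two dual edges away from face 0.\<close>

definition cell_points :: "quartic_type \<Rightarrow> int list \<Rightarrow> (int \<times> int \<times> int) list" where
  "cell_points T \<sigma> =
     filter (\<lambda>p. list_all (\<lambda>((i, j), s). triple_potential p i - triple_potential p j = 0 \<or>
         triple_potential p i - triple_potential p j = s) (zip (dual_edges T) \<sigma>))
       (List.product [-2..2] (List.product [-2..2] [-2..2]))"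

text \<open>If the faces have distinct values, orienting the edges by these values excludes directed
  cycles.\<close>

definition order_signs :: "quartic_type \<Rightarrow> int \<times> int \<times> int \<Rightarrow> int list" where
  "order_signs T u = map (\<lambda>(i, j). sgn (triple_potential u i - triple_potential u j)) (dual_edges T)"

text \<open>An exhaustive evaluation over at most 64 orientations with 125 candidate points
  each.\<close>

lemma cell_sizes_upper:
  "list_all (\<lambda>\<sigma>. cyclic_signs T \<sigma> \<or> List.member (cell_sizes T) (length (cell_points T \<sigma>)))
     (product_lists (replicate (length (dual_edges T)) [1, -1]))"
  by (cases T; hypsubst; code_simp)

text \<open>Two orderings of the faces suffice: for two conics and for a conic with two lines,
  \<open>(3, 2, 1)\<close> realises the smaller count and \<open>(3, 1, 2)\<close> the
  larger.\<close>

lemma cell_sizes_attained: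
  "list_all (\<lambda>s. list_ex (\<lambda>u. length (cell_points T (order_signs T u)) = s)
     [(3, 2, 1), (3, 1, 2)]) (cell_sizes T)"
  by (cases T; hypsubst; code_simp)

lemma dual_cycles_relation:
  assumes "\<kappa> \<in> set (dual_cycles T)"
  shows "length \<kappa> = length (dual_edges T)"
    and "\<exists>k<length \<kappa>. \<kappa> ! k \<noteq> 0"
    and "(\<Sum>k<length (dual_edges T). of_int (\<kappa> ! k) *\<^sub>R edge_vec (dual_edges T ! k)) = 0"
proof -
  have "list_all (\<lambda>\<kappa>. length \<kappa> = length (dual_edges T)) (dual_cycles T)"
    by (cases T) simp_all
  then show "length \<kappa> = length (dual_edges T)"
    using assms by (simp add: list_all_iff)
  have "list_all (list_ex (\<lambda>c. c \<noteq> 0)) (dual_cycles T)"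
    by (cases T) simp_all
  then have "list_ex (\<lambda>c. c \<noteq> 0) \<kappa>"
    using assms by (simp add: list_all_iff)
  then show "\<exists>k<length \<kappa>. \<kappa> ! k \<noteq> 0"
    by (simp add: list_ex_length)
  let ?S = "\<Sum>k<length (dual_edges T). of_int (\<kappa> ! k) *\<^sub>R edge_vec (dual_edges T ! k)"
  \<comment> \<open>Potential differences telescope around a cycle, so \<open>?S\<close> is
    orthogonal to every vector, in particular to itself.\<close>
  have "list_all (\<lambda>\<kappa>. (\<Sum>k<length (dual_edges T). of_int (\<kappa> ! k) * edge_diff (dual_edges T ! k) v) = 0)
      (dual_cycles T)" for v :: "real^3"
    by (cases T) (simp_all add: numeral_eq_Suc edge_diff_def)
  then have "?S \<bullet> v = 0" for v
    using assms by (simp add: list_all_iff inner_sum_left edge_vec_inner)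
  from this[of ?S] show "?S = 0" by simp
qed

abbreviation nth_edge_vec :: "quartic_type \<Rightarrow> nat \<Rightarrow> real^3" where
  "nth_edge_vec T k \<equiv> edge_vec (dual_edges T ! k)"

text \<open>A cyclic sign vector yields a second representation, with some coefficients zero, of the same
  point of the zonotope.\<close>

lemma extreme_not_cyclic:
  assumes a: "a extreme_point_of voronoi_cell (dual_gram T)"
    and \<sigma>: "length \<sigma> = length (dual_edges T)" "set \<sigma> \<subseteq> {1, -1}"
    and rep: "2 *\<^sub>R (dual_gram T *v a) = (\<Sum>k<length (dual_edges T). real_of_int (\<sigma> ! k) *\<^sub>R nth_edge_vec T k)"
  shows "\<not> cyclic_signs T \<sigma>"
proof
  assume "cyclic_signs T \<sigma>"
  then obtain \<kappa> c where \<kappa>: "\<kappa> \<in> set (dual_cycles T)" and c: "c = 1 \<or> c = (-1 :: int)"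
    and agr: "agrees (map ((*) c) \<kappa>) \<sigma>"
  proof -
    have "map uminus \<kappa> = map ((*) (-1)) \<kappa>" "\<kappa> = map ((*) 1) \<kappa>" for \<kappa> :: "int list"
      by (simp_all add: map_idI)
    then show ?thesis
      using \<open>cyclic_signs T \<sigma>\<close> that unfolding cyclic_signs_def list_ex_iff by metis
  qed
  \<comment> \<open>Subtracting the directed cycle leaves the point unchanged and annihilates the
    coefficients along the cycle.\<close>
  define s where "s k = real_of_int (\<sigma> ! k - c * \<kappa> ! k)" for k
  have agr': "\<kappa> ! k = 0 \<or> c * \<kappa> ! k = \<sigma> ! k" if "k < length (dual_edges T)" for k
  proof -
    have "(map ((*) c) \<kappa>) ! k = 0 \<or> (map ((*) c) \<kappa>) ! k = \<sigma> ! k"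
      using agr that \<sigma>(1) unfolding agrees_def by (auto dest: list_all2_nthD2)
    then show ?thesis using that dual_cycles_relation(1)[OF \<kappa>] c by auto
  qed
  have sgn: "\<bar>real_of_int (\<sigma> ! k)\<bar> = 1" if "k < length (dual_edges T)" for k
    using subsetD[OF \<sigma>(2) nth_mem[of k \<sigma>]] \<sigma>(1) that by auto
  have "(\<Sum>k<length (dual_edges T). s k *\<^sub>R nth_edge_vec T k) =
      2 *\<^sub>R (dual_gram T *v a)
      - of_int c *\<^sub>R (\<Sum>k<length (dual_edges T). of_int (\<kappa> ! k) *\<^sub>R nth_edge_vec T k)"
    by (simp add: rep s_def scaleR_diff_left sum_subtractf scaleR_sum_right)
  then have s: "2 *\<^sub>R (dual_gram T *v a) = (\<Sum>k<length (dual_edges T). s k *\<^sub>R nth_edge_vec T k)"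
    unfolding dual_cycles_relation(3)[OF \<kappa>] by simp
  have s_le: "\<bar>s k\<bar> \<le> 1" if "k < length (dual_edges T)" for k
    using agr'[OF that] sgn[OF that] by (auto simp: s_def simp del: of_int_diff of_int_mult)
  obtain k where k: "k < length (dual_edges T)" "\<kappa> ! k \<noteq> 0"
    using dual_cycles_relation(1,2)[OF \<kappa>] by auto
  have "s k = 0"
    using agr'[OF k(1)] k(2) by (simp add: s_def)
  moreover have "\<bar>s k\<bar> = 1"
    by (rule dual.extreme_coefficients[OF a s_le s k(1)])
  ultimately show False by simp
qed

section \<open>Counting Delaunay points by evaluation\<close>

lemma triple_potential_eq:
  assumes "i < 4"
  shows "triple_potential (n $ 1, n $ 2, n $ 3) i = potential (n :: int^3) i"
proof -
  from assms consider "i = 0" | "i = 1" | "i = 2" | "i = 3" by linarith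
  then show ?thesis by cases simp_all
qed

text \<open>Sign coefficients place \<open>a\<close> in the zonotope, and identifying vectors with
  triples reduces the count to a finite list. This serves vertices as well as points built from an
  orientation before they are known to be vertices.\<close>

lemma dual_delaunay_set:
  assumes \<sigma>: "length \<sigma> = length (dual_edges T)" "set \<sigma> \<subseteq> {1, -1}"
    and rep: "2 *\<^sub>R (dual_gram T *v a) = (\<Sum>k<length (dual_edges T). real_of_int (\<sigma> ! k) *\<^sub>R nth_edge_vec T k)"
  shows "a \<in> voronoi_cell (dual_gram T)"
    and "delaunay_set (dual_gram T) a = {n. \<forall>k<length (dual_edges T).
           edge_diff (dual_edges T ! k) n = 0 \<or> edge_diff (dual_edges T ! k) n = \<sigma> ! k}"
    and "finite (delaunay_set (dual_gram T) a)"
    and "card (delaunay_set (dual_gram T) a) = length (cell_points T \<sigma>)"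
proof -
  let ?D = "delaunay_set (dual_gram T) a" and ?m = "length (dual_edges T)"
  have sgn: "\<bar>real_of_int (\<sigma> ! k)\<bar> \<le> 1" if "k < ?m" for k
    using subsetD[OF \<sigma>(2) nth_mem[of k \<sigma>]] \<sigma>(1) that by auto
  show "a \<in> voronoi_cell (dual_gram T)"
    unfolding dual.voronoi_cell_eq_zonotope
    by (rule exI[of _ "\<lambda>k. real_of_int (\<sigma> ! k)"]) (simp add: sgn rep)
  show D: "?D = {n. \<forall>k<?m. edge_diff (dual_edges T ! k) n = 0 \<or> edge_diff (dual_edges T ! k) n = \<sigma> ! k}"
    using dual.delaunay_set_eq[OF sgn rep] by (simp add: edge_vec_inner edge_diff_real_vec)
  let ?f = "\<lambda>n :: int^3. (n $ 1, n $ 2, n $ 3)"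
  have "-2 \<le> n $ r \<and> n $ r \<le> 2" if "n \<in> ?D" for n r
  proof -
    from that have mem: "\<forall>k<?m. edge_diff (dual_edges T ! k) n = 0 \<or> edge_diff (dual_edges T ! k) n = \<sigma> ! k"
      unfolding D mem_Collect_eq .
    have "-1 \<le> edge_diff e n \<and> edge_diff e n \<le> 1" if "e \<in> set (dual_edges T)" for e
    proof -
      from that have "\<exists>k<?m. dual_edges T ! k = e" by (simp only: in_set_conv_nth)
      then obtain k where k: "k < ?m" "dual_edges T ! k = e" by blast
      have "edge_diff e n = 0 \<or> edge_diff e n = \<sigma> ! k"
        unfolding k(2)[symmetric] by (rule mem[rule_format, OF k(1)])
      moreover have "\<sigma> ! k = 1 \<or> \<sigma> ! k = -1"
        using subsetD[OF \<sigma>(2) nth_mem[of k \<sigma>]] \<sigma>(1) k(1) by simp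
      ultimately show ?thesis by presburger
    qed
    then have "list_all (\<lambda>e. -1 \<le> edge_diff e n \<and> edge_diff e n \<le> 1) (dual_edges T)"
      by (simp add: list_all_iff)
    then have "-2 \<le> n $ 1 \<and> n $ 1 \<le> 2 \<and> -2 \<le> n $ 2 \<and> n $ 2 \<le> 2 \<and> -2 \<le> n $ 3 \<and> n $ 3 \<le> 2"
      by (cases T) (simp_all add: edge_diff_def)
    then show ?thesis using exhaust_3[of r] by auto
  qed
  then have box: "?f n \<in> {-2..2} \<times> {-2..2} \<times> {-2..2}" if "n \<in> ?D" for n
    using that by simp
  have "list_all (\<lambda>((i, j), s). triple_potential (?f n) i - triple_potential (?f n) j = 0 \<or>
         triple_potential (?f n) i - triple_potential (?f n) j = s) (zip (dual_edges T) \<sigma>)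
      \<longleftrightarrow> (\<forall>k<?m. edge_diff (dual_edges T ! k) n = 0 \<or> edge_diff (dual_edges T ! k) n = \<sigma> ! k)" for n
  proof -
    have "triple_potential (?f n) (fst (dual_edges T ! k)) - triple_potential (?f n) (snd (dual_edges T ! k))
        = edge_diff (dual_edges T ! k) n" if "k < ?m" for k
      using dual_edges_bounds[OF nth_mem[OF that]] unfolding edge_diff_def by (simp only: triple_potential_eq)
    then show ?thesis
      unfolding list_all_length using \<sigma>(1) by (simp add: case_prod_beta del: triple_potential.simps right_minus_eq)
  qed
  then have "?f n \<in> set (cell_points T \<sigma>) \<longleftrightarrow> ?f n \<in> {-2..2} \<times> {-2..2} \<times> {-2..2} \<and> n \<in> ?D" for n
    unfolding D cell_points_def set_filter mem_Collect_eq set_product set_upto by (simp only:)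
  then have iff: "n \<in> ?D \<longleftrightarrow> ?f n \<in> set (cell_points T \<sigma>)" for n
    using box[of n] by metis
  have "?D = ?f -` set (cell_points T \<sigma>)"
    by (rule set_eqI) (simp only: vimage_eq iff)
  moreover have "surj ?f"
    by (rule surjI[of _ "\<lambda>(x, y, z). vector [x, y, z]"]) (auto simp: vector_3)
  ultimately have img: "?f ` ?D = set (cell_points T \<sigma>)"
    by (simp only: surj_image_vimage_eq)
  have inj: "inj_on ?f ?D" by (auto simp: inj_on_def vec_eq_iff forall_3)
  show "finite ?D"
    by (rule finite_imageD[OF _ inj]) (simp only: img List.finite_set)
  have "card ?D = card (set (cell_points T \<sigma>))"
    using card_image[OF inj] by (simp only: img)
  also have "\<dots> = length (cell_points T \<sigma>)"
    unfolding cell_points_def by (intro distinct_card distinct_filter distinct_product) auto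
  finally show "card ?D = length (cell_points T \<sigma>)" .
qed

lemma dual_extreme_cell_size:
  assumes a: "a extreme_point_of voronoi_cell (dual_gram T)"
  shows "finite (delaunay_set (dual_gram T) a)"
    and "card (delaunay_set (dual_gram T) a) \<in> set (cell_sizes T)"
proof -
  let ?m = "length (dual_edges T)"
  have "a \<in> voronoi_cell (dual_gram T)" using a by (simp add: extreme_point_of_def)
  then obtain s where s: "\<And>k. k < ?m \<Longrightarrow> \<bar>s k\<bar> \<le> 1"
      "2 *\<^sub>R (dual_gram T *v a) = (\<Sum>k<?m. s k *\<^sub>R nth_edge_vec T k)"
    unfolding dual.voronoi_cell_eq_zonotope by blast
  \<comment> \<open>Extremality forces each \<open>s k\<close> to be 1 or -1, so the default -1 is
    the correct sign.\<close>
  define \<sigma> :: "int list" where "\<sigma> = map (\<lambda>k. if s k = 1 then 1 else -1) [0..<?m]"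
  have "s k = of_int (\<sigma> ! k)" if "k < ?m" for k
    using dual.extreme_coefficients[OF a s that] that by (auto simp: \<sigma>_def abs_if split: if_splits)
  then have rep: "2 *\<^sub>R (dual_gram T *v a) = (\<Sum>k<?m. real_of_int (\<sigma> ! k) *\<^sub>R nth_edge_vec T k)"
    unfolding s(2) by (intro sum.cong) auto
  have \<sigma>: "length \<sigma> = ?m" "set \<sigma> \<subseteq> {1, -1}" by (auto simp: \<sigma>_def)
  then have "\<sigma> \<in> set (product_lists (replicate ?m [1, -1]))"
    using subsetD[OF \<sigma>(2) nth_mem] by (auto simp: product_lists_set list_all2_conv_all_nth)
  then have "cyclic_signs T \<sigma> \<or> length (cell_points T \<sigma>) \<in> set (cell_sizes T)"
    using cell_sizes_upper[of T] unfolding list_all_iff List.member_iff by blast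
  then show "finite (delaunay_set (dual_gram T) a)"
    and "card (delaunay_set (dual_gram T) a) \<in> set (cell_sizes T)"
    using extreme_not_cyclic[OF a \<sigma> rep] dual_delaunay_set[OF \<sigma> rep] by auto
qed

text \<open>The signs come from an ordering of the faces. Its upper level sets are Delaunay points
  that span the space, which makes the constructed point a vertex.\<close>

lemma dual_cell_size_attained:
  assumes "s \<in> set (cell_sizes T)"
  obtains a where "a extreme_point_of voronoi_cell (dual_gram T)"
    and "card (delaunay_set (dual_gram T) a) = s"
proof -
  let ?m = "length (dual_edges T)"
  obtain u where u: "u = (3, 2, 1) \<or> u = (3, 1, 2)" "length (cell_points T (order_signs T u)) = s"
    using cell_sizes_attained[of T] assms unfolding list_all_iff list_ex_iff by fastforce
  obtain n1 n2 n3 where n: "u = (n1, n2, n3)" by (cases u)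
  define v :: "int^3" where "v = vector [n1, n2, n3]"
  have v: "v $ 1 = n1" "v $ 2 = n2" "v $ 3 = n3" by (simp_all add: v_def vector_3)
  let ?\<sigma> = "order_signs T u"
  have nth: "?\<sigma> ! k = sgn (edge_diff (dual_edges T ! k) v)" if "k < ?m" for k
    using dual_edges_bounds[OF nth_mem[OF that]] that
    by (simp add: order_signs_def edge_diff_def case_prod_beta n triple_potential_eq[of _ v, unfolded v] del: triple_potential.simps)
  have "list_all (\<lambda>e. edge_diff e v \<noteq> 0) (dual_edges T)"
    using u(1) n v by (cases T) (auto simp: edge_diff_def)
  then have "edge_diff e v \<noteq> 0" if "e \<in> set (dual_edges T)" for e
    using that by (simp add: list_all_iff)
  then have "?\<sigma> ! k \<in> {1, -1}" if "k < ?m" for k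
    unfolding nth[OF that] using nth_mem[OF that] by (auto simp: sgn_if)
  moreover have len: "length ?\<sigma> = ?m" by (simp add: order_signs_def)
  ultimately have \<sigma>: "length ?\<sigma> = ?m" "set ?\<sigma> \<subseteq> {1, -1}"
    by (metis in_set_conv_nth subsetI)+
  obtain w where w: "dual_gram T *v w = (\<Sum>k<?m. real_of_int (?\<sigma> ! k) *\<^sub>R nth_edge_vec T k)"
    by (rule dual.gram_mult_surj)
  define a where "a = (1/2) *\<^sub>R w"
  have rep: "2 *\<^sub>R (dual_gram T *v a) = (\<Sum>k<?m. real_of_int (?\<sigma> ! k) *\<^sub>R nth_edge_vec T k)"
    by (simp add: a_def matrix_vector_mult_scaleR w)
  note D = dual_delaunay_set[OF \<sigma> rep]
  \<comment> \<open>Across an edge, the indicator of an upper level set changes by 0 or by the sign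
    of the potential difference; \<open>\<theta> \<ge> 1\<close> keeps face 0 outside the
    set.\<close>
  have chain: "vector [of_bool (n1 \<ge> \<theta>), of_bool (n2 \<ge> \<theta>), of_bool (n3 \<ge> \<theta>)] \<in> delaunay_set (dual_gram T) a"
    (is "?N \<in> _") if "\<theta> \<ge> 1" for \<theta>
  proof -
    have pot: "potential ?N i = of_bool (potential v i \<ge> \<theta>)" if "i < 4" for i
    proof -
      from that consider "i = 0" | "i = 1" | "i = 2" | "i = 3" by linarith
      then show ?thesis using \<open>\<theta> \<ge> 1\<close> by cases (simp_all add: vector_3 v)
    qed
    have "edge_diff (dual_edges T ! k) ?N = 0 \<or> edge_diff (dual_edges T ! k) ?N = ?\<sigma> ! k" if "k < ?m" for k
      unfolding nth[OF that] using dual_edges_bounds[OF nth_mem[OF that]]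
      by (simp add: edge_diff_def pot sgn_if)
    then show ?thesis unfolding D(2) by blast
  qed
  have "a extreme_point_of voronoi_cell (dual_gram T)"
  proof (rule dual.extreme_if_delaunay_set_spanning[OF D(1)])
    fix x assume "real_vec n \<bullet> x = 0" if "n \<in> delaunay_set (dual_gram T) a" for n
    \<comment> \<open>The thresholds 1, 2, 3 give nested sets of 3, 2 and 1 faces, whose indicators
      are linearly independent.\<close>
    from this[OF chain[of 1]] this[OF chain[of 2]] this[OF chain[of 3]]
    have "x $ 1 = 0 \<and> x $ 2 = 0 \<and> x $ 3 = 0"
      using u(1) n by (auto simp: inner_vec_def sum_3 vector_3)
    then show "x = 0" by (simp add: vec_eq_iff forall_3)
  qed
  then show ?thesis using that D(4) u(2) by simp
qed

section \<open>From the dual graph to potentials\<close>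

lemma surj_image_eqI:
  assumes "surj f" "\<And>x. f x \<in> S \<longleftrightarrow> x \<in> S'"
  shows "S = f ` S'"
proof -
  have "S' = f -` S" using assms(2) by auto
  then show ?thesis using surj_image_vimage_eq[OF assms(1)] by simp
qed

text \<open>The standard basis vectors are lattice points and hence in the image; in finite
  dimension surjectivity gives injectivity.\<close>

lemma bij_linear_of_bij_lattice:
  fixes A :: "real^3^3"
  assumes g: "bij g" and A: "\<And>n. A *v real_vec n = real_vec (g n)"
  shows "bij ((*v) A)"
proof -
  have "surj ((*v) A)"
  proof -
    have "\<exists>u. A *v u = axis i 1" for i
    proof -
      obtain n where "g n = axis i 1" using bij_is_surj[OF g] by (metis surjD)
      then have "A *v real_vec n = real_vec (axis i 1)" by (simp add: A)
      also have "real_vec (axis i 1) = axis i 1" by (simp add: axis_def vec_eq_iff)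
      finally show ?thesis by blast
    qed
    then obtain u where u: "\<And>i. A *v u i = axis i 1" by metis
    have "A *v (\<Sum>i\<in>UNIV. (y $ i) *\<^sub>R u i) = y" for y
      using basis_expansion[of y]
      by (simp add: linear_sum[OF matrix_vector_mul_linear] matrix_vector_mult_scaleR u scalar_mult_eq_scaleR)
    then show ?thesis by (rule surjI[of _ "\<lambda>y. \<Sum>i\<in>UNIV. (y $ i) *\<^sub>R u i"])
  qed
  then show ?thesis
    using linear_surjective_imp_injective[OF matrix_vector_mul_linear, of A] by (simp add: bij_def)
qed

text \<open>The map \<open>A\<close> is an isometry from \<open>B'\<close> to \<open>B\<close> that
  permutes the lattice, so it carries along everything defined by the metric and the
  lattice.\<close>

lemma voronoi_delaunay_transfer:
  fixes A :: "real^3^3"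
  assumes g: "bij g" and A: "\<And>n. A *v real_vec n = real_vec (g n)"
    and q: "\<And>v. qform B' v = qform B (A *v v)"
  shows "voronoi_cell B = (*v) A ` voronoi_cell B'"
    and "delaunay_set B (A *v a) = g ` delaunay_set B' a"
    and "{a. a extreme_point_of voronoi_cell B} = (*v) A ` {a. a extreme_point_of voronoi_cell B'}"
proof -
  note bij = bij_linear_of_bij_lattice[OF g A]
  have qd: "qform B' (a - real_vec n) = qform B (A *v a - real_vec (g n))" for a n
    by (simp add: q A matrix_vector_mult_diff_distrib)
  have all: "(\<forall>n. P n) \<longleftrightarrow> (\<forall>n. P (g n))" for P
    using bij_is_surj[OF g] by (metis surjD)
  have mem: "A *v a \<in> voronoi_cell B \<longleftrightarrow> a \<in> voronoi_cell B'" for a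
    unfolding voronoi_cell_def mem_Collect_eq qd unfolding q by (rule all)
  then show V: "voronoi_cell B = (*v) A ` voronoi_cell B'"
    by (rule surj_image_eqI[OF bij_is_surj[OF bij]])
  have "g n \<in> delaunay_set B (A *v a) \<longleftrightarrow> n \<in> delaunay_set B' a" for n a
    unfolding delaunay_set_def mem_Collect_eq qd unfolding q ..
  then show "delaunay_set B (A *v a) = g ` delaunay_set B' a"
    by (rule surj_image_eqI[OF bij_is_surj[OF g]])
  have seg: "A *v a \<in> open_segment (A *v x) (A *v y) \<longleftrightarrow> a \<in> open_segment x y" for a x y
  proof -
    have "open_segment (A *v x) (A *v y) = (*v) A ` open_segment x y"
      by (rule open_segment_linear_image[OF matrix_vector_mul_linear bij_is_inj[OF bij]])
    then show ?thesis using bij_is_inj[OF bij] by (simp add: inj_image_mem_iff)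
  qed
  have "A *v a extreme_point_of voronoi_cell B \<longleftrightarrow> a extreme_point_of voronoi_cell B'" for a
    unfolding extreme_point_of_def mem unfolding V ball_simps seg ..
  then show "{a. a extreme_point_of voronoi_cell B} = (*v) A ` {a. a extreme_point_of voronoi_cell B'}"
    by (intro surj_image_eqI[OF bij_is_surj[OF bij]]) (simp only: mem_Collect_eq)
qed

text \<open>Each entry of \<open>ys\<close> consumes one element of its fibre. This labels the arcs
  by a prescribed list of edges when only the number of arcs between two vertices is known.\<close>

lemma list_with_fibres:
  assumes "finite A" "\<And>y. card {x \<in> A. f x = y} = count_list ys y"
  shows "\<exists>xs. distinct xs \<and> set xs = A \<and> map f xs = ys"
  using assms
proof (induction ys arbitrary: A)
  case Nil
  have "A = {}"
  proof (rule ccontr)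
    assume "A \<noteq> {}"
    then obtain x where x: "x \<in> A" by blast
    then have "card {x' \<in> A. f x' = f x} > 0"
      using Nil(1) by (auto simp: card_gt_0_iff)
    then show False using Nil(2) by simp
  qed
  then show ?case by simp
next
  case (Cons y ys)
  have "card {x \<in> A. f x = y} > 0" using Cons.prems(2)[of y] by simp
  then obtain x where x: "x \<in> A" "f x = y" by (auto simp: card_gt_0_iff)
  have "card {x' \<in> A - {x}. f x' = z} = count_list ys z" for z
  proof (cases "z = y")
    case True
    have "{x' \<in> A - {x}. f x' = z} = {x' \<in> A. f x' = z} - {x}" by auto
    then show ?thesis using Cons.prems x True by simp
  next
    case False
    then have "{x' \<in> A - {x}. f x' = z} = {x' \<in> A. f x' = z}" using x by auto
    then show ?thesis using Cons.prems False by simp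
  qed
  with Cons.IH[of "A - {x}"] Cons.prems(1)
  obtain xs where "distinct xs" "set xs = A - {x}" "map f xs = ys" by auto
  then show ?case using x by (intro exI[of _ "x # xs"]) auto
qed

section \<open>Arcs and cycles of the dual graph\<close>

lemma primal_edges_count:
  "list_all (\<lambda>i. list_all (\<lambda>j.
      length (filter (\<lambda>(a, b). a = i \<and> b = j \<or> a = j \<and> b = i) (primal_edges T)) = num_edges T i j)
    [0..<length (components T)]) [0..<length (components T)]"
  by (cases T; hypsubst; code_simp)

lemma oriented_dual_graph_arcs:
  assumes "oriented_dual_graph T G"
  obtains \<phi> es where "bij_betw \<phi> {..<length (components T)} (verts G)"
    and "distinct es" "set es = arcs G" "length es = length (dual_edges T)"
    and "\<And>k. k < length (dual_edges T) \<Longrightarrow>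
      {tail G (es ! k), head G (es ! k)} = {\<phi> (fst (primal_edges T ! k)), \<phi> (snd (primal_edges T ! k))}"
proof -
  interpret fin_digraph G using assms by (simp add: oriented_dual_graph_def)
  let ?n = "length (components T)"
  obtain \<phi> where \<phi>: "bij_betw \<phi> {..<?n} (verts G)"
    and num: "\<And>i j. i < ?n \<Longrightarrow> j < ?n \<Longrightarrow>
      card {e \<in> arcs G. {tail G e, head G e} = {\<phi> i, \<phi> j}} = num_edges T i j"
    using assms unfolding oriented_dual_graph_def by blast
  \<comment> \<open>Unordered pairs of ends, because the orientation of \<open>G\<close> is
    arbitrary.\<close>
  let ?f = "\<lambda>e. {tail G e, head G e}"
  let ?ys = "map (\<lambda>(i, j). {\<phi> i, \<phi> j}) (primal_edges T)"
  have prim: "list_all (\<lambda>(i, j). i < ?n \<and> j < ?n) (primal_edges T)"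
    by (cases T) simp_all
  have inj: "\<phi> i = \<phi> j \<longleftrightarrow> i = j" if "i < ?n" "j < ?n" for i j
    using bij_betw_imp_inj_on[OF \<phi>] that by (auto simp: inj_on_def)
  have count: "count_list ?ys {\<phi> i, \<phi> j} = num_edges T i j" if "i < ?n" "j < ?n" for i j
  proof -
    have "count_list (map (\<lambda>(i, j). {\<phi> i, \<phi> j}) xs) {\<phi> i, \<phi> j}
        = length (filter (\<lambda>(a, b). a = i \<and> b = j \<or> a = j \<and> b = i) xs)"
      if "list_all (\<lambda>(i, j). i < ?n \<and> j < ?n) xs" for xs
      using that \<open>i < ?n\<close> \<open>j < ?n\<close> by (induction xs) (auto simp: doubleton_eq_iff inj)
    from this[OF prim] have "count_list ?ys {\<phi> i, \<phi> j}
        = length (filter (\<lambda>(a, b). a = i \<and> b = j \<or> a = j \<and> b = i) (primal_edges T))" .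
    also have "\<dots> = num_edges T i j"
      using primal_edges_count[of T] that by (simp add: list_all_iff)
    finally show ?thesis .
  qed
  \<comment> \<open>Every arc joins some \<open>\<phi> i\<close> and \<open>\<phi> j\<close>; any
    other value of \<open>y\<close> has an empty fibre and does not occur in the list.\<close>
  have "card {e \<in> arcs G. ?f e = y} = count_list ?ys y" for y
  proof (cases "\<exists>i<?n. \<exists>j<?n. y = {\<phi> i, \<phi> j}")
    case True
    then obtain i j where "i < ?n" "j < ?n" "y = {\<phi> i, \<phi> j}" by blast
    then show ?thesis using num count by (simp only:)
  next
    case False
    have "?f e \<noteq> y" if "e \<in> arcs G" for e
    proof -
      have "tail G e \<in> \<phi> ` {..<?n}" "head G e \<in> \<phi> ` {..<?n}"
        using that wellformed bij_betw_imp_surj_on[OF \<phi>] by auto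
      then obtain i j where "i < ?n" "tail G e = \<phi> i" "j < ?n" "head G e = \<phi> j" by auto
      then have "\<exists>i<?n. \<exists>j<?n. ?f e = {\<phi> i, \<phi> j}" by auto
      with False show ?thesis by metis
    qed
    then have empty: "{e \<in> arcs G. ?f e = y} = {}" by (simp only: Collect_empty_eq) simp
    have notin: "y \<notin> set ?ys"
    proof
      assume "y \<in> set ?ys"
      then obtain e where e: "e \<in> set (primal_edges T)" "y = {\<phi> (fst e), \<phi> (snd e)}"
        by (auto simp: case_prod_beta)
      then have "fst e < ?n" "snd e < ?n" using prim by (auto simp: list_all_iff)
      with False e(2) show False by metis
    qed
    show ?thesis unfolding empty card.empty count_notin[OF notin] ..
  qed
  then have "\<exists>es. distinct es \<and> set es = arcs G \<and> map ?f es = ?ys"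
    by (rule list_with_fibres[OF finite_arcs])
  then obtain es where es: "distinct es" "set es = arcs G" "map ?f es = ?ys" by blast
  have len: "length es = length (dual_edges T)"
    using arg_cong[OF es(3), of length] by (simp add: length_primal_edges)
  have ends: "?f (es ! k) = {\<phi> (fst (primal_edges T ! k)), \<phi> (snd (primal_edges T ! k))}"
    if "k < length (dual_edges T)" for k
    using arg_cong[OF es(3), of "\<lambda>xs. xs ! k"] that len by (simp add: length_primal_edges case_prod_beta)
  show ?thesis by (rule that[OF \<phi> es(1,2) len ends])
qed

lemma potential_Suc:
  "potential v (Suc (Suc 0)) = v $ 2" "potential v (Suc (Suc (Suc 0))) = v $ 3"
  using potential_simps(4,5)[of v] by (simp_all only: numeral_2_eq_2 numeral_3_eq_3)

text \<open>Since the dual graph of the curve is planar, flows are differences of potentials on its faces.\<close>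

lemma flow_iff_potential:
  fixes d :: "nat \<Rightarrow> int"
  shows "(\<forall>i<length (components T). (\<Sum>k<length (dual_edges T).
            d k * (of_bool (snd (primal_edges T ! k) = i) - of_bool (fst (primal_edges T ! k) = i))) = 0)
     \<longleftrightarrow> (\<exists>p :: int^3. \<forall>k<length (dual_edges T). d k = edge_diff (dual_edges T ! k) p)"
    (is "?flow \<longleftrightarrow> ?pot")
proof
  assume ?flow
  \<comment> \<open>The flow is integrated from face 0 along a spanning tree of dual edges;
    conservation at the vertices then gives the remaining edges.\<close>
  define p :: "int^3" where "p = (case T of
      Irreducible_Quartic \<Rightarrow> vector [- d 0, - d 1, - d 2]
    | Nodal_Cubic_And_Line \<Rightarrow> vector [- d 1, - d 1 - d 2, - d 0]
    | Two_Conics \<Rightarrow> vector [- d 0, - d 0 - d 1, d 3]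
    | Conic_And_Two_Lines \<Rightarrow> vector [- d 0, - d 4, d 3]
    | Four_Lines \<Rightarrow> vector [- d 0, d 2, - d 4])"
  have "\<forall>k<length (dual_edges T). d k = edge_diff (dual_edges T ! k) p"
    using \<open>?flow\<close>
    by (cases T) (simp_all add: p_def numeral_eq_Suc All_less_Suc2 edge_diff_def potential_Suc vector_3)
  then show ?pot by blast
next
  assume ?pot
  then obtain p :: "int^3" where "\<forall>k<length (dual_edges T). d k = edge_diff (dual_edges T ! k) p"
    by blast
  then show ?flow
    by (cases T) (simp_all add: numeral_eq_Suc All_less_Suc2 edge_diff_def potential_Suc)
qed

lemma boundary_eq_sum:
  assumes "finite (arcs G)"
  shows "boundary G c v = (\<Sum>e\<in>arcs G. c e * (of_bool (head G e = v) - of_bool (tail G e = v)))"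
proof -
  have *: "(\<Sum>e\<in>{e \<in> arcs G. P e}. c e) = (\<Sum>e\<in>arcs G. c e * of_bool (P e))" for P
    using assms by (simp add: sum.inter_filter of_bool_def if_distrib cong: if_cong)
  show ?thesis
    by (simp add: boundary_def * right_diff_distrib sum_subtractf)
qed

text \<open>The labelling of the arcs transports the description of flows by potentials;
  \<open>\<epsilon>\<close> corrects the arcs oriented against the list.\<close>

lemma H1_planar:
  assumes "oriented_dual_graph T G"
  obtains es and \<epsilon> :: "nat \<Rightarrow> int" where "distinct es" "set es = arcs G" "length es = length (dual_edges T)"
    and "\<And>k. \<epsilon> k * \<epsilon> k = 1"
    and "\<And>c. c \<in> H1 G \<longleftrightarrow> (\<forall>e. e \<notin> arcs G \<longrightarrow> c e = 0) \<and>
      (\<exists>p. \<forall>k<length (dual_edges T). c (es ! k) = \<epsilon> k * edge_diff (dual_edges T ! k) p)"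
proof -
  let ?m = "length (dual_edges T)" and ?n = "length (components T)"
  from oriented_dual_graph_arcs[OF assms] obtain \<phi> es where \<phi>: "bij_betw \<phi> {..<?n} (verts G)"
    and es: "distinct es" "set es = arcs G" "length es = ?m"
    and ends: "\<And>k. k < ?m \<Longrightarrow>
      {tail G (es ! k), head G (es ! k)} = {\<phi> (fst (primal_edges T ! k)), \<phi> (snd (primal_edges T ! k))}"
    by blast
  \<comment> \<open>A loop receives the sign 1; its contribution to the boundary is zero.\<close>
  define \<epsilon> :: "nat \<Rightarrow> int" where
    "\<epsilon> k = (if tail G (es ! k) = \<phi> (fst (primal_edges T ! k)) then 1 else -1)" for k
  have \<epsilon>: "\<epsilon> k * \<epsilon> k = 1" for k by (simp add: \<epsilon>_def)
  have "list_all (\<lambda>e. fst e < ?n \<and> snd e < ?n) (primal_edges T)"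
    by (cases T) simp_all
  then have prim: "fst (primal_edges T ! k) < ?n" "snd (primal_edges T ! k) < ?n" if "k < ?m" for k
    using that by (auto simp: list_all_length length_primal_edges)
  have incidence: "(of_bool (head G (es ! k) = \<phi> i) - of_bool (tail G (es ! k) = \<phi> i) :: int) =
      \<epsilon> k * (of_bool (snd (primal_edges T ! k) = i) - of_bool (fst (primal_edges T ! k) = i))"
    if "k < ?m" "i < ?n" for k i
  proof -
    have inj: "\<phi> j = \<phi> i \<longleftrightarrow> j = i" if "j < ?n" for j
      using bij_betw_imp_inj_on[OF \<phi>] that \<open>i < ?n\<close> by (auto simp: inj_on_def)
    show ?thesis
      using ends[OF that(1)] inj[OF prim(1)[OF that(1)]] inj[OF prim(2)[OF that(1)]]
      by (auto simp: \<epsilon>_def doubleton_eq_iff)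
  qed
  have fin: "finite (arcs G)" using es(2) by (metis List.finite_set)
  have bd: "boundary G c (\<phi> i) = (\<Sum>k<?m. (\<epsilon> k * c (es ! k)) *
      (of_bool (snd (primal_edges T ! k) = i) - of_bool (fst (primal_edges T ! k) = i)))"
    if "i < ?n" for c i
  proof -
    have "boundary G c (\<phi> i) = (\<Sum>k<?m. c (es ! k) * (of_bool (head G (es ! k) = \<phi> i) - of_bool (tail G (es ! k) = \<phi> i)))"
      unfolding boundary_eq_sum[OF fin]
      using sum.reindex_bij_betw[OF bij_betw_nth[OF es(1) _ refl, of "{..<?m}"],
          where g = "\<lambda>e. c e * (of_bool (head G e = \<phi> i) - of_bool (tail G e = \<phi> i))"] es
      by simp
    also have "\<dots> = (\<Sum>k<?m. (\<epsilon> k * c (es ! k)) *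
      (of_bool (snd (primal_edges T ! k) = i) - of_bool (fst (primal_edges T ! k) = i)))"
      by (intro sum.cong) (use incidence that in \<open>simp_all add: mult_ac\<close>)
    finally show ?thesis .
  qed
  have solve: "\<epsilon> k * x = y \<longleftrightarrow> x = \<epsilon> k * y" for k x y
    by (auto simp: \<epsilon>_def)
  have "(\<forall>v\<in>verts G. boundary G c v = 0) \<longleftrightarrow>
      (\<exists>p. \<forall>k<?m. c (es ! k) = \<epsilon> k * edge_diff (dual_edges T ! k) p)" for c
  proof -
    have "(\<forall>v\<in>verts G. boundary G c v = 0) \<longleftrightarrow> (\<forall>i<?n. boundary G c (\<phi> i) = 0)"
      using bij_betw_imp_surj_on[OF \<phi>] by (metis (no_types, lifting) image_iff lessThan_iff)
    also have "\<dots> \<longleftrightarrow> (\<exists>p :: int^3. \<forall>k<?m. \<epsilon> k * c (es ! k) = edge_diff (dual_edges T ! k) p)"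
      by (subst flow_iff_potential [symmetric]) (simp add: bd)
    finally show ?thesis unfolding solve .
  qed
  then show ?thesis using that[OF es \<epsilon>] by (simp add: H1_def)
qed

text \<open>The coordinates of a cycle in the chosen basis and its integer potential determine each
  other, so the passage \<open>g\<close> between them is bijective. The quadratic form is a sum of
  squares over the arcs, where the signs \<open>\<epsilon>\<close> disappear.\<close>

lemma riemann_matrix_dual_gram:
  assumes "oriented_dual_graph T G" "is_riemann_matrix G B"
  obtains A g where "bij g" "\<And>n. A *v real_vec n = real_vec (g n)"
    and "\<And>v. qform B v = qform (dual_gram T) (A *v v)"
proof -
  let ?m = "length (dual_edges T)" and ?e = "\<lambda>k. dual_edges T ! k"
  obtain es and \<epsilon> :: "nat \<Rightarrow> int" where es: "distinct es" "set es = arcs G" "length es = ?m"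
    and \<epsilon>: "\<And>k. \<epsilon> k * \<epsilon> k = 1"
    and H1: "\<And>c. c \<in> H1 G \<longleftrightarrow> (\<forall>e. e \<notin> arcs G \<longrightarrow> c e = 0) \<and>
      (\<exists>p. \<forall>k<?m. c (es ! k) = \<epsilon> k * edge_diff (?e k) p)"
    using H1_planar[OF assms(1)] by blast
  obtain \<omega> where \<omega>: "\<And>i. \<omega> i \<in> H1 G"
      "\<And>c. c \<in> H1 G \<Longrightarrow> \<exists>!k :: 3 \<Rightarrow> int. c = (\<lambda>e. \<Sum>i\<in>UNIV. k i * \<omega> i e)"
    and B: "B = (\<chi> i j. real_of_int (\<Sum>e\<in>arcs G. \<omega> i e * \<omega> j e))"
    using assms(2) unfolding is_riemann_matrix_def is_H1_basis_def by blast
  obtain \<gamma> where \<gamma>: "\<And>i k. k < ?m \<Longrightarrow> \<omega> i (es ! k) = \<epsilon> k * edge_diff (?e k) (\<gamma> i)"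
    using \<omega>(1) unfolding H1 by metis
  have outside: "\<omega> i e = 0" if "e \<notin> arcs G" for i e using \<omega>(1)[of i] that unfolding H1 by blast
  define g where "g n = (\<Sum>i\<in>UNIV. (n $ i) *s \<gamma> i)" for n :: "int^3"
  define A :: "real^3^3" where "A = (\<chi> r i. real_of_int (\<gamma> i $ r))"
  have A: "A *v v = (\<Sum>i\<in>UNIV. (v $ i) *s real_vec (\<gamma> i))" for v
    by (simp add: A_def vec_eq_iff matrix_vector_mult_def mult.commute)
  have cycle: "(\<Sum>i\<in>UNIV. n $ i * \<omega> i (es ! k)) = \<epsilon> k * edge_diff (?e k) (g n)" if "k < ?m" for n k
    unfolding g_def edge_diff_sum \<gamma>[OF that] by (simp add: sum_distrib_left mult_ac)
  have arcs: "\<exists>k<?m. e = es ! k" if "e \<in> arcs G" for e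
    using that es by (metis in_set_conv_nth)
  define F where "F k = (\<lambda>e. \<Sum>i\<in>UNIV. k i * \<omega> i e)" for k :: "3 \<Rightarrow> int"
  have F_ex1: "\<exists>!k. c = F k" if "c \<in> H1 G" for c
    using \<omega>(2)[OF that] unfolding F_def .
  have F_arc: "F (vec_nth n) (es ! k) = \<epsilon> k * edge_diff (?e k) (g n)" if "k < ?m" for n k
    unfolding F_def by (rule cycle[OF that])
  have F_outside: "F k e = 0" if "e \<notin> arcs G" for k e
    by (simp add: F_def outside[OF that])
  have F_mem: "F (vec_nth n) \<in> H1 G" for n
    unfolding H1 using F_arc F_outside by blast
  have "inj g"
  proof (rule injI)
    fix n n' assume "g n = g n'"
    then have "F (vec_nth n) e = F (vec_nth n') e" for e
      by (cases "e \<in> arcs G") (auto dest!: arcs simp: F_arc F_outside)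
    then have "F (vec_nth n) = F (vec_nth n')" by blast
    then have "vec_nth n = vec_nth n'" using F_ex1[OF F_mem[of n]] by blast
    then show "n = n'" by (simp only: vec_nth_inject)
  qed
  moreover have "surj g"
  proof -
    have "\<exists>n. g n = p" for p
    proof -
      \<comment> \<open>The cycle with potential \<open>p\<close>; \<open>THE\<close> recovers the
        index of an arc in \<open>es\<close>.\<close>
      define c where "c e = (if e \<in> arcs G then \<epsilon> (THE k. k < ?m \<and> es ! k = e) * edge_diff (?e (THE k. k < ?m \<and> es ! k = e)) p else 0)" for e
      have "(THE k'. k' < ?m \<and> es ! k' = es ! k) = k" if "k < ?m" for k
        by (rule the_equality) (use that es(3) nth_eq_iff_index_eq[OF es(1)] in auto)
      then have c: "c (es ! k) = \<epsilon> k * edge_diff (?e k) p" if "k < ?m" for k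
        using that es nth_mem[of k es] by (simp add: c_def)
      moreover have "c e = 0" if "e \<notin> arcs G" for e using that by (simp add: c_def)
      ultimately have "c \<in> H1 G" unfolding H1 by blast
      then obtain k' where "c = F k'" using F_ex1 by blast
      then have k': "c = F (vec_nth (\<chi> i. k' i))" by (simp only: vec_lambda_inverse[OF UNIV_I])
      have "\<epsilon> k * edge_diff (?e k) (g (\<chi> i. k' i)) = \<epsilon> k * edge_diff (?e k) p" if "k < ?m" for k
        using c[OF that] F_arc[OF that, of "\<chi> i. k' i"] by (simp only: k')
      then have "\<forall>k<?m. edge_diff (?e k) (g (\<chi> i. k' i) - p) = 0"
        using \<epsilon> unfolding edge_diff_linear by (metis mult_cancel_left mult_zero_left right_minus_eq zero_neq_one)
      then have "g (\<chi> i. k' i) - p = 0"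
        by (intro edge_diff_faithful[of T] all_nth_imp_all_set[where P = "\<lambda>e. edge_diff e _ = 0"])
      then show ?thesis by auto
    qed
    then show ?thesis unfolding surj_def by metis
  qed
  ultimately have "bij g" by (simp add: bij_def)
  moreover have "A *v real_vec n = real_vec (g n)" for n
    by (simp add: A g_def vec_eq_iff)
  moreover have "qform B v = qform (dual_gram T) (A *v v)" for v
  proof -
    have "qform B v = (\<Sum>e\<in>arcs G. (\<Sum>i\<in>UNIV. v $ i * of_int (\<omega> i e))\<^sup>2)"
    proof -
      have "qform B v = (\<Sum>i\<in>UNIV. \<Sum>j\<in>UNIV. \<Sum>e\<in>arcs G. (v $ i * of_int (\<omega> i e)) * (v $ j * of_int (\<omega> j e)))"
        by (simp add: qform_def B inner_vec_def matrix_vector_mult_def sum_distrib_left sum_distrib_right mult_ac)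
      also have "\<dots> = (\<Sum>i\<in>UNIV. \<Sum>e\<in>arcs G. \<Sum>j\<in>UNIV. (v $ i * of_int (\<omega> i e)) * (v $ j * of_int (\<omega> j e)))"
        by (intro sum.cong refl sum.swap)
      also have "\<dots> = (\<Sum>e\<in>arcs G. \<Sum>i\<in>UNIV. \<Sum>j\<in>UNIV. (v $ i * of_int (\<omega> i e)) * (v $ j * of_int (\<omega> j e)))"
        by (rule sum.swap)
      finally show ?thesis by (simp add: power2_eq_square sum_product)
    qed
    also have "\<dots> = (\<Sum>k<?m. (\<Sum>i\<in>UNIV. v $ i * of_int (\<omega> i (es ! k)))\<^sup>2)"
      using sum.reindex_bij_betw[OF bij_betw_nth[OF es(1) _ refl, of "{..<?m}"],
          where g = "\<lambda>e. (\<Sum>i\<in>UNIV. v $ i * real_of_int (\<omega> i e))\<^sup>2"] es by simp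
    also have "\<dots> = (\<Sum>k<?m. (edge_vec (?e k) \<bullet> (A *v v))\<^sup>2)"
    proof (intro sum.cong refl)
      fix k assume "k \<in> {..<?m}"
      then have k: "k < ?m" by simp
      have "(\<Sum>i\<in>UNIV. v $ i * real_of_int (\<omega> i (es ! k))) = of_int (\<epsilon> k) * edge_diff (?e k) (A *v v)"
        unfolding A edge_diff_sum edge_diff_real_vec \<gamma>[OF k] by (simp add: sum_distrib_left mult_ac)
      moreover have "(real_of_int (\<epsilon> k))\<^sup>2 = 1"
        using \<epsilon>[of k] by (metis of_int_1 of_int_mult power2_eq_square)
      ultimately show "(\<Sum>i\<in>UNIV. v $ i * real_of_int (\<omega> i (es ! k)))\<^sup>2 = (edge_vec (?e k) \<bullet> (A *v v))\<^sup>2"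
        by (simp add: power_mult_distrib edge_vec_inner)
    qed
    finally show ?thesis by (simp add: dual.qform_eq)
  qed
  ultimately show ?thesis using that by blast
qed

lemma riemann_matrix_symmetric: "is_riemann_matrix G B \<Longrightarrow> transpose B = B"
  unfolding is_riemann_matrix_def by (auto simp: transpose_def vec_eq_iff mult.commute)

section \<open>Limits and counts for an arbitrary Riemann matrix\<close>

theorem theorem4:
  fixes T :: quartic_type
    and G :: "('v, 'e) pre_digraph"
    and B :: "real ^ 3 ^ 3"
    and B\<^sub>0 :: "complex ^ 3 ^ 3"
  assumes "oriented_dual_graph T G"
    and "is_riemann_matrix G B"
    and "transpose B\<^sub>0 = B\<^sub>0"
    and "pos_def_mat (Re_mat B\<^sub>0)"
  shows "(\<forall>a. a extreme_point_of voronoi_cell B \<longrightarrow>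
            finite (delaunay_set B a) \<and>
            (\<forall>x :: complex ^ 3.
               ((\<lambda>t :: real. riemann_theta
                     (x - (\<i> * complex_of_real t) *s complex_vec (B *v a))
                     (t *\<^sub>R complex_mat B + B\<^sub>0))
                 \<longlongrightarrow> (\<Sum>n\<in>delaunay_set B a. theta_term x B\<^sub>0 n)) at_top)) \<and>
         (\<lambda>a. card (delaunay_set B a)) ` {a. a extreme_point_of voronoi_cell B} =
           (case T of
              Irreducible_Quartic \<Rightarrow> {8}
            | Nodal_Cubic_And_Line \<Rightarrow> {6}
            | Two_Conics \<Rightarrow> {4, 6}
            | Conic_And_Two_Lines \<Rightarrow> {4, 5}
            | Four_Lines \<Rightarrow> {4})"
proof -
  obtain A g where g: "bij g" and A: "\<And>n. A *v real_vec n = real_vec (g n)"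
    and q: "\<And>v. qform B v = qform (dual_gram T) (A *v v)"
    using riemann_matrix_dual_gram[OF assms(1,2)] by metis
  note transfer = voronoi_delaunay_transfer[OF g A q]
  have inj: "inj_on g D" for D using g by (meson bij_is_inj inj_on_subset subset_UNIV)
  have fin: "finite (delaunay_set B a)" if "a extreme_point_of voronoi_cell B" for a
  proof -
    have "A *v a extreme_point_of voronoi_cell (dual_gram T)" using that transfer(3) by blast
    from dual_extreme_cell_size(1)[OF this] show ?thesis
      unfolding transfer(2) by (rule finite_imageD[OF _ inj])
  qed
  have card: "card (delaunay_set (dual_gram T) (A *v a)) = card (delaunay_set B a)" for a
    unfolding transfer(2) by (rule card_image[OF inj])
  have "(\<lambda>a. card (delaunay_set B a)) ` {a. a extreme_point_of voronoi_cell B} =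
      (\<lambda>a. card (delaunay_set (dual_gram T) a)) ` {a. a extreme_point_of voronoi_cell (dual_gram T)}"
    unfolding transfer(3) image_image card ..
  also have "\<dots> = set (cell_sizes T)"
  proof (intro subset_antisym subsetI)
    fix s assume "s \<in> set (cell_sizes T)"
    then obtain a where "a extreme_point_of voronoi_cell (dual_gram T)"
        "card (delaunay_set (dual_gram T) a) = s"
      by (rule dual_cell_size_attained)
    then show "s \<in> (\<lambda>a. card (delaunay_set (dual_gram T) a)) ` {a. a extreme_point_of voronoi_cell (dual_gram T)}"
      by (intro image_eqI[of _ _ a]) simp_all
  qed (auto intro: dual_extreme_cell_size(2))
  also have "\<dots> = (case T of
              Irreducible_Quartic \<Rightarrow> {8}
            | Nodal_Cubic_And_Line \<Rightarrow> {6}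
            | Two_Conics \<Rightarrow> {4, 6}
            | Conic_And_Two_Lines \<Rightarrow> {4, 5}
            | Four_Lines \<Rightarrow> {4})"
    by (cases T) simp_all
  finally show ?thesis
    using fin theta_degeneration[OF riemann_matrix_symmetric[OF assms(2)] assms(4)]
    by (auto simp: extreme_point_of_def)
qed

end
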